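(* Let $\gamma>1$, $m>0$, $\delta>0$, and let $\mu,\lambda$ satisfy either ($\mu=1$ and $0\le\lambda\le 2$) or ($\mu>1$ and $\lambda\ge 0$). Let $(u_0,v_0)\in X_{m,\delta}$ and suppose that for some constants $u_->0$ and $v_-\in\mathbb{R}$, $$\lim_{x\to-\infty}(u_0(x),v_0(x))=(u_-,v_-)$$ and $$\sup_{(x,y)\in\mathbb{R}^2}|s(0,x)+r(0,y)|<\frac{1}{\gamma-1}\,u_-^{-(\gamma-1)/2}.$$ Let $(u,v)$ be the $C^1$ solution of the Cauchy problem $$u_t-v_x=0,\qquad v_t+p(u)_x=-\frac{\lambda}{(1+t)^\mu}v,\qquad (u,v)(0,x)=(u_0(x),v_0(x)),$$ with lifespan $T^*$. Then there exist $m_1>0$ and $\delta_1>0$ such that $(u(t),v(t))\in X_{m_1,\delta_1}$ for all $t\in[0,T^* )$. Furthermore, there is a constant $K_{m,\delta}>0$, depending on $m$ and $\delta$ (and on the fixed parameters $\gamma,\mu,\lambda$), such that if $(u_0,v_0)\in X_{m,\delta}$ satisfies $\lim_{x\to-\infty}(u_0(x),v_0(x))=(u_-,v_-)$ and $\sup_{(x,y)\in\mathbb{R}^2}|s(0,x)+r(0,y)|<\frac{1}{\gamma-1}\,u_-^{-(\gamma-1)/2}$ for some constants $u_->0$ and $v_-\in\mathbb{R}$, and if in addition $$r_x(0,x_0)\le -K_{m,\delta}\quad\text{or}\quad s_x(0,x_0)\le -K_{m,\delta}$$ for some $x_0\in\mathbb{R}$, then $T^*<\infty$.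
   Context: Pressure: $p(u)=u^{-\gamma}/\gamma$ with $\gamma>1$. Put $c(u)=\sqrt{-p'(u)}=u^{-(\gamma+1)/2}$ and $\eta(u)=\int_u^\infty c(\xi)\,d\xi=\frac{2}{\gamma-1}u^{-(\gamma-1)/2}$. For a solution $(u,v)$ with $u>0$, the Riemann invariants are $r(t,x)=v(t,x)-\eta(u(t,x))$ and $s(t,x)=v(t,x)+\eta(u(t,x))$; at $t=0$ they are computed from $(u_0,v_0)$. $C^1_b(\mathbb{R})$ is the set of bounded $C^1$ functions with bounded first derivative. For $m,\delta>0$, $$X_{m,\delta}=\{(u,v)\in C^1_b(\mathbb{R})\times C^1_b(\mathbb{R}) : \|u\|_{L^\infty}+\|v\|_{L^\infty}\le m,\ u(x)\ge\delta\ \text{for all }x\in\mathbb{R}\}.$$ For initial data in $C^1_b(\mathbb{R})$ with $\inf u_0>0$ the Cauchy problem ($t\ge0$, $x\in\mathbb{R}$) has a unique local $C^1$ solution. The lifespan is $$T^*=\sup\Big\{T>0 : \text{the }C^1\text{ solution exists on }[0,T)\times\mathbb{R}\text{ and }\sup_{t\in[0,T)}\big(\|(u,v)(t)\|_{L^\infty}+\|(u_t,v_t)(t)\|_{L^\infty}+\|(u_x,v_x)(t)\|_{L^\infty}+\|p'(u(t))\|_{L^\infty}\big)<\infty\Big\}.$$ *)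

theory Defs
  imports "HOL-Probability.Essential_Supremum"
begin

definition pressure :: "real \<Rightarrow> real \<Rightarrow> real" where
  "pressure \<gamma> u = u powr (- \<gamma>) / \<gamma>"

definition wave_speed :: "real \<Rightarrow> real \<Rightarrow> real" where
  "wave_speed \<gamma> u = sqrt (- deriv (pressure \<gamma>) u)"

definition eta :: "real \<Rightarrow> real \<Rightarrow> real" where
  "eta \<gamma> u = (LBINT \<xi>=ereal u..\<infinity>. wave_speed \<gamma> \<xi>)"

lemma pressure_has_real_derivative:
  assumes "\<gamma> > 1" "u > 0"
  shows "(pressure \<gamma> has_real_derivative - (u powr (- \<gamma> - 1))) (at u)"
proof -
  have "((\<lambda>u. u powr (- \<gamma>) / \<gamma>) has_real_derivative (- \<gamma> * u powr (- \<gamma> - 1)) / \<gamma>) (at u)"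
    using assms by (intro DERIV_cdivide has_real_derivative_powr) auto
  then show ?thesis
    using assms by (simp add: pressure_def[abs_def])
qed

lemma wave_speed_eq:
  assumes "\<gamma> > 1" "u > 0"
  shows "wave_speed \<gamma> u = u powr (- ((\<gamma> + 1) / 2))"
proof -
  have "deriv (pressure \<gamma>) u = - (u powr (- \<gamma> - 1))"
    using pressure_has_real_derivative[OF assms] by (rule DERIV_imp_deriv)
  moreover have "u powr (- \<gamma> - 1) = (u powr (- ((\<gamma> + 1) / 2)))\<^sup>2"
  proof -
    have "- \<gamma> - 1 = - ((\<gamma> + 1) / 2) + - ((\<gamma> + 1) / 2)"
      by (simp add: field_simps)
    then show ?thesis
      by (simp only: powr_add power2_eq_square)
  qed
  ultimately show ?thesis
    by (simp add: wave_speed_def)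
qed

lemma eta_eq:
  assumes \<gamma>: "\<gamma> > 1" and u: "u > 0"
  shows "eta \<gamma> u = 2 / (\<gamma> - 1) * u powr (- ((\<gamma> - 1) / 2))"
proof -
  define F where "F = (\<lambda>x::real. - (2 / (\<gamma> - 1) * x powr (- ((\<gamma> - 1) / 2))))"
  define f where "f = (\<lambda>x::real. x powr (- ((\<gamma> + 1) / 2)))"
  have D: "(F has_real_derivative f x) (at x)" if "x > 0" for x
  proof -
    have "((\<lambda>x. x powr (- ((\<gamma> - 1) / 2))) has_real_derivative
        - ((\<gamma> - 1) / 2) * x powr (- ((\<gamma> - 1) / 2) - 1)) (at x)"
      using that by (rule has_real_derivative_powr)
    moreover have "- ((\<gamma> - 1) / 2) - 1 = - ((\<gamma> + 1) / 2)"
      by (simp add: field_simps)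
    ultimately have "((\<lambda>x. x powr (- ((\<gamma> - 1) / 2))) has_real_derivative
        - ((\<gamma> - 1) / 2) * f x) (at x)"
      by (simp only: f_def)
    from DERIV_minus[OF DERIV_cmult[OF this, of "2 / (\<gamma> - 1)"]] show ?thesis
      unfolding F_def using \<gamma> by simp
  qed
  have "(LBINT \<xi>=ereal u..\<infinity>. f \<xi>) = 0 - F u"
  proof (rule interval_integral_FTC_nonneg)
    show "(F has_real_derivative f x) (at x)" if "ereal u < ereal x" for x
      using D u that by auto
    show "isCont f x" if "ereal u < ereal x" for x
      unfolding f_def using u that by (intro continuous_intros) auto
    show "AE x in lborel. ereal u < ereal x \<longrightarrow> ereal x < \<infinity> \<longrightarrow> 0 \<le> f x"
      by (simp add: f_def)
    have "isCont F u"
      using D[OF u] by (rule DERIV_isCont)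
    then have "(F \<longlongrightarrow> F u) (at_right u)"
      by (simp add: isCont_def filterlim_at_split)
    then show "((F \<circ> real_of_ereal) \<longlongrightarrow> F u) (at_right (ereal u))"
      by (simp add: ereal_tendsto_simps)
    have "((\<lambda>x::real. x powr (- ((\<gamma> - 1) / 2))) \<longlongrightarrow> 0) at_top"
      using \<gamma> by (intro tendsto_neg_powr filterlim_ident) auto
    then have "(F \<longlongrightarrow> - (2 / (\<gamma> - 1) * 0)) at_top"
      unfolding F_def by (intro tendsto_intros)
    then show "((F \<circ> real_of_ereal) \<longlongrightarrow> 0) (at_left \<infinity>)"
      by (simp add: ereal_tendsto_simps)
  qed auto
  moreover have "eta \<gamma> u = (LBINT \<xi>=ereal u..\<infinity>. f \<xi>)"
    unfolding eta_def f_def using \<gamma> u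
    by (intro interval_integral_cong) (auto simp: wave_speed_eq einterval_def)
  ultimately show ?thesis
    by (simp add: F_def)
qed

definition riemann_r :: "real \<Rightarrow> real \<Rightarrow> real \<Rightarrow> real" where
  "riemann_r \<gamma> u v = v - eta \<gamma> u"

definition riemann_s :: "real \<Rightarrow> real \<Rightarrow> real \<Rightarrow> real" where
  "riemann_s \<gamma> u v = v + eta \<gamma> u"

(* The norm is extended-real valued, so that finiteness has to be stated explicitly. *)
definition Linf_norm :: "(real \<Rightarrow> 'a::real_normed_vector) \<Rightarrow> ereal" where
  "Linf_norm f = esssup lborel (\<lambda>x. ereal (norm (f x)))"

definition C1b :: "(real \<Rightarrow> real) set" where
  "C1b = {f. f C1_differentiable_on UNIV \<and> bounded (range f) \<and> bounded (range (deriv f))}"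

definition X_set :: "real \<Rightarrow> real \<Rightarrow> ((real \<Rightarrow> real) \<times> (real \<Rightarrow> real)) set" where
  "X_set m \<delta> = {(u, v). u \<in> C1b \<and> v \<in> C1b \<and> Linf_norm u + Linf_norm v \<le> ereal m \<and> (\<forall>x. \<delta> \<le> u x)}"

(* Functions of (t, x) are curried with time first. The time derivative is one-sided at t = 0
   and two-sided at every t > 0. *)
definition pdt :: "(real \<Rightarrow> real \<Rightarrow> real) \<Rightarrow> real \<Rightarrow> real \<Rightarrow> real" where
  "pdt w t x = vector_derivative (\<lambda>\<tau>. w \<tau> x) (at t within {0..})"

definition pdx :: "(real \<Rightarrow> real \<Rightarrow> real) \<Rightarrow> real \<Rightarrow> real \<Rightarrow> real" where
  "pdx w t x = deriv (w t) x"

definition C1_on_strip :: "real \<Rightarrow> (real \<Rightarrow> real \<Rightarrow> real) \<Rightarrow> bool" where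
  "C1_on_strip T w \<longleftrightarrow>
     (\<forall>t\<in>{0..<T}. \<forall>x. (\<lambda>\<tau>. w \<tau> x) differentiable (at t within {0..}) \<and> w t differentiable (at x)) \<and>
     continuous_on ({0..<T} \<times> UNIV) (\<lambda>(t, x). pdt w t x) \<and>
     continuous_on ({0..<T} \<times> UNIV) (\<lambda>(t, x). pdx w t x)"

(* C^1 solution of the Cauchy problem on [0,T) x R. Positivity of u is part of the notion, since
   the pressure is only meaningful there (powr is total). *)
definition C1_solution ::
  "real \<Rightarrow> real \<Rightarrow> real \<Rightarrow> (real \<Rightarrow> real) \<Rightarrow> (real \<Rightarrow> real) \<Rightarrow> real
    \<Rightarrow> (real \<Rightarrow> real \<Rightarrow> real) \<Rightarrow> (real \<Rightarrow> real \<Rightarrow> real) \<Rightarrow> bool" where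
  "C1_solution \<gamma> \<mu> lam u0 v0 T u v \<longleftrightarrow>
     C1_on_strip T u \<and> C1_on_strip T v \<and>
     (\<forall>x. u 0 x = u0 x \<and> v 0 x = v0 x) \<and>
     (\<forall>t\<in>{0..<T}. \<forall>x. u t x > 0 \<and>
        pdt u t x - pdx v t x = 0 \<and>
        pdt v t x + pdx (\<lambda>\<tau> y. pressure \<gamma> (u \<tau> y)) t x = - (lam / (1 + t) powr \<mu>) * v t x)"

definition bounded_on_strip ::
  "real \<Rightarrow> real \<Rightarrow> (real \<Rightarrow> real \<Rightarrow> real) \<Rightarrow> (real \<Rightarrow> real \<Rightarrow> real) \<Rightarrow> bool" where
  "bounded_on_strip \<gamma> T u v \<longleftrightarrow>
     (SUP t\<in>{0..<T}.
        Linf_norm (\<lambda>x. (u t x, v t x)) + Linf_norm (\<lambda>x. (pdt u t x, pdt v t x))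
        + Linf_norm (\<lambda>x. (pdx u t x, pdx v t x)) + Linf_norm (\<lambda>x. deriv (pressure \<gamma>) (u t x))) < \<infinity>"

(* The lifespan is attached to the data: solutions on [0,T) with finite bound are unique, so the
   existential quantifier over (u, v) refers to "the" solution. *)
definition lifespan ::
  "real \<Rightarrow> real \<Rightarrow> real \<Rightarrow> (real \<Rightarrow> real) \<Rightarrow> (real \<Rightarrow> real) \<Rightarrow> ereal" where
  "lifespan \<gamma> \<mu> lam u0 v0 =
     Sup (ereal ` {T. T > 0 \<and> (\<exists>u v. C1_solution \<gamma> \<mu> lam u0 v0 T u v \<and> bounded_on_strip \<gamma> T u v)})"

(* (u, v) is the solution up to the lifespan T*. The bound on every [0,T) with T < T* is what
   singles it out: without it u could approach 0 as |x| grows, the propagation speed would be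
   unbounded, and the uniqueness argument for C^1 solutions would break down. *)
definition maximal_C1_solution ::
  "real \<Rightarrow> real \<Rightarrow> real \<Rightarrow> (real \<Rightarrow> real) \<Rightarrow> (real \<Rightarrow> real)
    \<Rightarrow> (real \<Rightarrow> real \<Rightarrow> real) \<Rightarrow> (real \<Rightarrow> real \<Rightarrow> real) \<Rightarrow> bool" where
  "maximal_C1_solution \<gamma> \<mu> lam u0 v0 u v \<longleftrightarrow>
     (\<forall>T>0. ereal T < lifespan \<gamma> \<mu> lam u0 v0 \<longrightarrow>
        C1_solution \<gamma> \<mu> lam u0 v0 T u v \<and> bounded_on_strip \<gamma> T u v)"

end

(*
Along characteristics of opposite speeds both Riemann invariants are damped by -a (r + s) / 2 with
a = lam (1 + t)^(-mu), so the pair (r, -s) exchanges values: the derivative of each along its own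
characteristic is a/2 times (the other minus itself).  Hence the maximum of (r, -s), and likewise that
of (s, -r), does not increase in time.  The smallness of s(x) + r(y), together with the limit at
minus infinity, forces r <= - eta(u_-) / 4 and s >= eta(u_-) / 4 at time 0.  The first pair then keeps
eta(u) = (s - r) / 2 away from 0, so u stays bounded, and the second pair bounds v and eta(u), so u
stays away from 0.  All constants depend on m and delta only, as u_- <= m.

For the blow-up let w be r or s and q = sqrt(c) w_x along a characteristic of w.  With an
antiderivative Phi of sqrt(c), the quantity Z = q + a Phi(u) / 2 satisfies
Z' = - (gamma + 1) / 4 * u^((gamma - 3) / 4) * q^2 - a q / 2 + a' Phi(u) / 2,
and the bounds on u turn this into Z' <= - k Z^2 as long as Z is sufficiently negative.
*)
theory Submission
  imports Defs
begin

text \<open>Two kinds of bounds must be kept apart. The finite supremum in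
  \<open>bounded_on_strip\<close> yields constants \<open>l\<close> and \<open>B\<close> that depend
  on the solution and on the strip. They serve only qualitative purposes: finite speed of
  propagation, globally Lipschitz characteristic fields, dominated convergence. No constant of the
  theorem may depend on them; those come from \<open>ul\<close> and \<open>uh\<close>, which the
  maximum principle supplies in terms of \<open>m\<close> and \<open>\<delta>\<close>. On the whole
  line a supremum need not be attained, so the maximum principle is proved on the backward triangle
  of dependence of one point, which is compact because c(u) <= c(l). The weight sqrt(c) is forced:
  the equation for w_x contains the product of w_x with the slope of the other invariant, with
  coefficient - c' / (2 c), while u changes along the characteristic at a rate equal to that other
  slope. A weight G(u) cancels the product exactly when G' / G = c' / (2 c). The lifespan is a
  supremum of existence times, so for blow-up it is enough to bound each existence time separately,
  with whatever solution comes with it.\<close>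

subsection \<open>Functions of time and space with a joint derivative\<close>

text \<open>The derivative is a total one, so that the chain rule is available along every curve.
  Working within \<open>I \<times> UNIV\<close> makes it one-sided at the ends of \<open>I\<close>.
  The partial derivatives are arguments so that the differential equations can be substituted for
  them.\<close>

definition has_gradient_on ::
  "real set \<Rightarrow> (real \<Rightarrow> real \<Rightarrow> real) \<Rightarrow> (real \<Rightarrow> real \<Rightarrow> real) \<Rightarrow> (real \<Rightarrow> real \<Rightarrow> real) \<Rightarrow> bool" where
  "has_gradient_on I w wt wx \<longleftrightarrow>
     (\<forall>t\<in>I. \<forall>x. ((\<lambda>p. w (fst p) (snd p)) has_derivative (\<lambda>d. wt t x * fst d + wx t x * snd d))
        (at (t, x) within I \<times> UNIV))"

lemma has_gradient_onD:
  assumes "has_gradient_on I w wt wx" "t \<in> I"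
  shows "((\<lambda>p. w (fst p) (snd p)) has_derivative (\<lambda>d. wt t x * fst d + wx t x * snd d))
           (at (t, x) within I \<times> UNIV)"
  using assms by (auto simp: has_gradient_on_def)

lemma has_gradient_on_subset:
  assumes "has_gradient_on I w wt wx" "J \<subseteq> I"
  shows "has_gradient_on J w wt wx"
  unfolding has_gradient_on_def
proof (intro ballI allI)
  fix t x assume "t \<in> J"
  with assms have "t \<in> I" by auto
  from has_gradient_onD[OF assms(1) this] show
    "((\<lambda>p. w (fst p) (snd p)) has_derivative (\<lambda>d. wt t x * fst d + wx t x * snd d)) (at (t, x) within J \<times> UNIV)"
    by (rule has_derivative_subset) (use assms in auto)
qed

lemma has_gradient_on_cong:
  assumes "has_gradient_on I w wt wx" "\<And>t x. t \<in> I \<Longrightarrow> wt t x = wt' t x"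
  shows "has_gradient_on I w wt' wx"
  using assms by (simp add: has_gradient_on_def)

text \<open>The free time component \<open>g\<close> covers characteristics (identity), backward
  motion (\<open>t - h\<close>) and a fixed time slice (constant).\<close>

lemma has_gradient_on_along:
  assumes w: "has_gradient_on I w wt wx"
    and g: "(g has_real_derivative g') (at s within J)"
    and X: "(X has_real_derivative X') (at s within J)"
    and "s \<in> J" "g ` J \<subseteq> I"
  shows "((\<lambda>s. w (g s) (X s)) has_real_derivative wt (g s) (X s) * g' + wx (g s) (X s) * X') (at s within J)"
proof -
  have 1: "((\<lambda>s. (g s, X s)) has_derivative (\<lambda>h. (g' * h, X' * h))) (at s within J)"
    using g X by (intro has_derivative_Pair) (auto simp: has_field_derivative_def)
  have "((\<lambda>p. w (fst p) (snd p)) has_derivative (\<lambda>d. wt (g s) (X s) * fst d + wx (g s) (X s) * snd d))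
           (at (g s, X s) within (\<lambda>s. (g s, X s)) ` J)"
    by (rule has_derivative_subset[OF has_gradient_onD[OF w]]) (use assms in auto)
  from diff_chain_within[OF 1 this]
  have "((\<lambda>s. w (g s) (X s)) has_derivative
      (\<lambda>h. wt (g s) (X s) * (g' * h) + wx (g s) (X s) * (X' * h))) (at s within J)"
    by (simp add: o_def)
  then show ?thesis
    unfolding has_field_derivative_def
    by (rule has_derivative_eq_rhs) (auto simp: fun_eq_iff algebra_simps)
qed

lemma has_gradient_on_continuous:
  assumes "has_gradient_on I w wt wx"
  shows "continuous_on (I \<times> UNIV) (\<lambda>p. w (fst p) (snd p))"
  unfolding continuous_on_eq_continuous_within
  using has_derivative_continuous[OF has_gradient_onD[OF assms]] by auto

lemma has_gradient_on_snd:
  assumes "has_gradient_on I w wt wx" "t \<in> I"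
  shows "(w t has_real_derivative wx t x) (at x)"
  using has_gradient_on_along[OF assms(1), of "\<lambda>_. t" 0 x UNIV "\<lambda>x. x" 1] assms(2) by simp

lemma has_gradient_on_add:
  assumes "has_gradient_on I w wt wx" "has_gradient_on I z zt zx"
  shows "has_gradient_on I (\<lambda>t x. w t x + z t x) (\<lambda>t x. wt t x + zt t x) (\<lambda>t x. wx t x + zx t x)"
  unfolding has_gradient_on_def
proof (intro ballI allI)
  fix t x assume t: "t \<in> I"
  have "((\<lambda>p. w (fst p) (snd p) + z (fst p) (snd p)) has_derivative
      (\<lambda>d. (wt t x * fst d + wx t x * snd d) + (zt t x * fst d + zx t x * snd d))) (at (t, x) within I \<times> UNIV)"
    by (intro has_derivative_add has_gradient_onD[OF assms(1) t] has_gradient_onD[OF assms(2) t])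
  then show "((\<lambda>p. w (fst p) (snd p) + z (fst p) (snd p)) has_derivative
      (\<lambda>d. (wt t x + zt t x) * fst d + (wx t x + zx t x) * snd d)) (at (t, x) within I \<times> UNIV)"
    by (simp add: algebra_simps)
qed

lemma has_gradient_on_compose:
  assumes w: "has_gradient_on I w wt wx"
    and h: "\<And>t x. t \<in> I \<Longrightarrow> (h has_real_derivative h' (w t x)) (at (w t x))"
  shows "has_gradient_on I (\<lambda>t x. h (w t x)) (\<lambda>t x. h' (w t x) * wt t x) (\<lambda>t x. h' (w t x) * wx t x)"
  unfolding has_gradient_on_def
proof (intro ballI allI)
  fix t x assume t: "t \<in> I"
  have "(h has_derivative (*) (h' (w t x))) (at (w (fst (t, x)) (snd (t, x))))"
    using h[OF t, of x] by (simp add: has_field_derivative_def)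
  from has_derivative_compose[OF has_gradient_onD[OF w t] this]
  show "((\<lambda>p. h (w (fst p) (snd p))) has_derivative
      (\<lambda>d. h' (w t x) * wt t x * fst d + h' (w t x) * wx t x * snd d)) (at (t, x) within I \<times> UNIV)"
    by (simp add: algebra_simps)
qed

lemma has_gradient_on_minus:
  assumes "has_gradient_on I w wt wx"
  shows "has_gradient_on I (\<lambda>t x. - w t x) (\<lambda>t x. - wt t x) (\<lambda>t x. - wx t x)"
  using has_gradient_on_compose[OF assms, of uminus "\<lambda>_. -1"] by (simp add: DERIV_minus)

text \<open>A time derivative at the point together with a space derivative that is continuous in
  both variables already gives total differentiability. The bounded linear operators only put
  \<open>pdx\<close> into the form that \<open>has_derivative_partialsI\<close> expects.\<close>

lemma C1_strip_has_gradient: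
  assumes "C1_on_strip T w"
  shows "has_gradient_on {0..<T} w (pdt w) (pdx w)"
  unfolding has_gradient_on_def
proof (intro ballI allI)
  fix t x assume t: "t \<in> {0..<T}"
  have 1: "((\<lambda>\<tau>. w \<tau> x) has_derivative (\<lambda>h. pdt w t x * h)) (at t within {0..<T})"
  proof -
    have "((\<lambda>\<tau>. w \<tau> x) has_vector_derivative pdt w t x) (at t within {0..})"
      using assms t unfolding C1_on_strip_def pdt_def by (auto simp flip: vector_derivative_works)
    then have "((\<lambda>\<tau>. w \<tau> x) has_vector_derivative pdt w t x) (at t within {0..<T})"
      by (rule has_vector_derivative_within_subset) auto
    then show ?thesis
      by (simp add: has_vector_derivative_def mult.commute)
  qed
  have 2: "(w s has_derivative blinfun_apply (pdx w s y *\<^sub>R id_blinfun)) (at y within UNIV)"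
    if "s \<in> {0..<T}" "y \<in> UNIV" for s y
  proof -
    have "w s differentiable at y"
      using assms that unfolding C1_on_strip_def by blast
    then have "(w s has_real_derivative pdx w s y) (at y)"
      unfolding pdx_def by (simp add: DERIV_deriv_iff_real_differentiable)
    then show ?thesis
      unfolding has_field_derivative_def
      by (rule has_derivative_eq_rhs) (auto simp: blinfun.bilinear_simps)
  qed
  have 3: "continuous (at (t, x) within {0..<T} \<times> UNIV) (\<lambda>(t, x). pdx w t x *\<^sub>R (id_blinfun :: real \<Rightarrow>\<^sub>L real))"
  proof -
    have "continuous_on ({0..<T} \<times> UNIV) (\<lambda>p. (case p of (t, x) \<Rightarrow> pdx w t x) *\<^sub>R (id_blinfun :: real \<Rightarrow>\<^sub>L real))"
      using assms unfolding C1_on_strip_def by (intro continuous_intros) auto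
    then show ?thesis
      using t by (auto simp: continuous_on_eq_continuous_within case_prod_unfold)
  qed
  from has_derivative_partialsI[OF 1 2 3]
  have "((\<lambda>(x, y). w x y) has_derivative (\<lambda>(tx, ty). pdt w t x * tx + blinfun_apply (pdx w t x *\<^sub>R id_blinfun) ty))
     (at (t, x) within {0..<T} \<times> UNIV)" by auto
  then show "((\<lambda>p. w (fst p) (snd p)) has_derivative (\<lambda>d. pdt w t x * fst d + pdx w t x * snd d))
     (at (t, x) within {0..<T} \<times> UNIV)"
    by (simp add: case_prod_unfold blinfun.bilinear_simps)
qed

subsection \<open>A maximum principle for counter-propagating waves\<close>

text \<open>At an interior-in-time maximum over the trapezoid \<open>\<bar>y - x\<bar> \<le> C (\<tau> - t)\<close> one may still move
  backwards along the characteristic direction, since the trapezoid widens at the maximal speed.\<close>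

lemma backward_increase:
  assumes f: "has_gradient_on {0..\<tau>} f ft fx"
    and t: "0 < t" "t \<le> \<tau>" and "\<bar>y - x\<bar> \<le> C * (\<tau> - t)" "\<bar>b\<bar> \<le> C"
    and neg: "ft t y - b * fx t y < e"
  obtains t' y' where "0 \<le> t'" "t' \<le> \<tau>" "\<bar>y' - x\<bar> \<le> C * (\<tau> - t')" "f t y - e * t < f t' y' - e * t'"
proof -
  have "((\<lambda>h. f (t - h) (y + b * h)) has_real_derivative ft (t - 0) (y + b * 0) * (-1) + fx (t - 0) (y + b * 0) * b) (at 0 within {0..t})"
    by (rule has_gradient_on_along[OF f])
      (use t in \<open>auto intro!: derivative_eq_intros\<close>)
  then have "((\<lambda>h. f (t - h) (y + b * h) - e * (t - h)) has_real_derivative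
      (ft (t - 0) (y + b * 0) * (-1) + fx (t - 0) (y + b * 0) * b) - e * (-1)) (at 0 within {0..t})"
    by (rule DERIV_diff) (auto intro!: derivative_eq_intros)
  from has_real_derivative_pos_inc_right[OF this] neg
  obtain d where d: "d > 0" "\<And>h. h > 0 \<Longrightarrow> h \<le> t \<Longrightarrow> h < d \<Longrightarrow>
      f t y - e * t < f (t - h) (y + b * h) - e * (t - h)"
    by (auto simp: algebra_simps)
  define h where "h = min (d / 2) t"
  have h: "h > 0" "h \<le> t" "h < d" using d(1) t by (auto simp: h_def)
  have "\<bar>b * h\<bar> \<le> C * h" using assms(5) h by (simp add: abs_mult mult_right_mono)
  then have "\<bar>y + b * h - x\<bar> \<le> C * (\<tau> - (t - h))"
    using assms(4) by (simp add: algebra_simps)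
  with d(2)[OF h] h t show ?thesis
    by (intro that[of "t - h" "y + b * h"]) auto
qed

text \<open>Where \<open>max f g\<close> is maximal at a positive time, the larger function has a
  source of sign at most 0, so moving back along its own characteristic does not decrease it.
  Subtracting \<open>e * t\<close> makes this strict and contradicts maximality; hence the maximum
  lies at time 0, and \<open>e\<close> tends to 0 at the end.\<close>

lemma exchange_maximum_principle:
  assumes f: "has_gradient_on {0..\<tau>} f ft fx" and g: "has_gradient_on {0..\<tau>} g gt gx"
    and "0 \<le> \<tau>"
    and b: "\<And>t y. t \<in> {0..\<tau>} \<Longrightarrow> \<bar>b t y\<bar> \<le> C"
    and \<alpha>: "\<And>t. t \<in> {0..\<tau>} \<Longrightarrow> 0 \<le> \<alpha> t"
    and feq: "\<And>t y. t \<in> {0..\<tau>} \<Longrightarrow> ft t y - b t y * fx t y = \<alpha> t * (g t y - f t y)"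
    and geq: "\<And>t y. t \<in> {0..\<tau>} \<Longrightarrow> gt t y + b t y * gx t y = \<alpha> t * (f t y - g t y)"
    and init: "\<And>y. f 0 y \<le> k" "\<And>y. g 0 y \<le> k"
  shows "f \<tau> x \<le> k \<and> g \<tau> x \<le> k"
proof -
  have C: "C \<ge> 0" using b[of 0 0] \<open>0 \<le> \<tau>\<close> by force
  \<comment> \<open>The backward triangle of dependence with apex \<open>(\<tau>, x)\<close>. The
    box makes compactness immediate, and the membership rule that follows shows that it cuts nothing
    off.\<close>
  define D where "D = {0..\<tau>} \<times> {x - C * \<tau>..x + C * \<tau>} \<inter> {p. \<bar>snd p - x\<bar> \<le> C * (\<tau> - fst p)}"
  have D: "(t, y) \<in> D \<longleftrightarrow> 0 \<le> t \<and> t \<le> \<tau> \<and> \<bar>y - x\<bar> \<le> C * (\<tau> - t)" for t y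
  proof -
    have "C * (\<tau> - t) \<le> C * \<tau>" if "0 \<le> t" using that C by (simp add: mult_left_mono)
    then show ?thesis unfolding D_def by (auto simp: abs_le_iff)
  qed
  have "compact D"
    unfolding D_def by (intro compact_Int_closed compact_Times closed_Collect_le) (auto intro!: continuous_intros)
  have apex: "(\<tau>, x) \<in> D" using \<open>0 \<le> \<tau>\<close> by (simp add: D)
  have sub: "D \<subseteq> {0..\<tau>} \<times> UNIV" by (auto simp: D_def)
  have key: "max (f \<tau> x) (g \<tau> x) \<le> k + e * \<tau>" if e: "e > 0" for e
  proof -
    define F where "F = (\<lambda>p. max (f (fst p) (snd p)) (g (fst p) (snd p)) - e * fst p)"
    have "continuous_on D F"
      unfolding F_def
      by (intro continuous_intros continuous_on_max)
        (auto intro: continuous_on_subset[OF has_gradient_on_continuous sub] f g)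
    then obtain p where p: "p \<in> D" "\<And>q. q \<in> D \<Longrightarrow> F q \<le> F p"
      using continuous_attains_sup[OF \<open>compact D\<close>] apex by (metis empty_iff)
    obtain t y where ty: "p = (t, y)" by (cases p)
    have tD: "0 \<le> t" "t \<le> \<tau>" "\<bar>y - x\<bar> \<le> C * (\<tau> - t)" using p(1) by (auto simp: ty D)
    have le: "f t' y' - e * t' \<le> F p" "g t' y' - e * t' \<le> F p"
      if "0 \<le> t'" "t' \<le> \<tau>" "\<bar>y' - x\<bar> \<le> C * (\<tau> - t')" for t' y'
      using p(2)[of "(t', y')"] that by (auto simp: D F_def)
    have "t = 0"
    proof (rule ccontr)
      assume "t \<noteq> 0"
      then have t: "0 < t" "t \<le> \<tau>" "t \<in> {0..\<tau>}" using tD by auto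
      show False
      proof (cases "g t y \<le> f t y")
        case True
        have "\<alpha> t * (g t y - f t y) \<le> 0" using True \<alpha>[OF t(3)] by (simp add: mult_le_0_iff)
        with feq[OF t(3), of y] e have neg: "ft t y - b t y * fx t y < e" by simp
        obtain t' y' where *: "0 \<le> t'" "t' \<le> \<tau>" "\<bar>y' - x\<bar> \<le> C * (\<tau> - t')" "f t y - e * t < f t' y' - e * t'"
          by (rule backward_increase[OF f t(1,2) tD(3) b[OF t(3)] neg])
        from le(1)[OF *(1-3)] *(4) True show False by (simp add: F_def ty)
      next
        case False
        have "\<alpha> t * (f t y - g t y) \<le> 0" using False \<alpha>[OF t(3)] by (simp add: mult_le_0_iff)
        with geq[OF t(3), of y] e have neg: "gt t y - (- b t y) * gx t y < e" by simp
        obtain t' y' where *: "0 \<le> t'" "t' \<le> \<tau>" "\<bar>y' - x\<bar> \<le> C * (\<tau> - t')" "g t y - e * t < g t' y' - e * t'"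
          by (rule backward_increase[OF g t(1,2) tD(3) _ neg]) (use b[OF t(3)] in auto)
        from le(2)[OF *(1-3)] *(4) False show False by (simp add: F_def ty)
      qed
    qed
    then have "F p \<le> k" using init by (simp add: F_def ty)
    with p(2)[OF apex] have "F (\<tau>, x) \<le> k" by simp
    then have "max (f \<tau> x) (g \<tau> x) - e * \<tau> \<le> k" by (simp only: F_def fst_conv snd_conv)
    then show ?thesis by linarith
  qed
  have "max (f \<tau> x) (g \<tau> x) \<le> k"
  proof (rule field_le_epsilon)
    fix e :: real assume "e > 0"
    \<comment> \<open>The tilt is scaled so that its total effect up to time \<open>\<tau>\<close>
      is at most \<open>e\<close>; the added 1 covers \<open>\<tau> = 0\<close>.\<close>
    have "e / (\<tau> + 1) * \<tau> \<le> e" using \<open>e > 0\<close> \<open>0 \<le> \<tau>\<close> by (simp add: field_simps)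
    with key[of "e / (\<tau> + 1)"] \<open>e > 0\<close> \<open>0 \<le> \<tau>\<close> show "max (f \<tau> x) (g \<tau> x) \<le> k + e"
      by simp
  qed
  then show ?thesis by simp
qed

subsection \<open>Characteristics\<close>

text \<open>One Lipschitz constant for all times lets a single fixed point give the curve on all of
  \<open>{0..\<tau>}\<close>. The unknown \<open>\<phi>\<close> is the displacement from
  \<open>x0\<close> divided by exp (2 L t): integrating L exp (2 L r) gives at most half of exp (2 L
  s), hence the contraction factor 1/2.\<close>

lemma picard_global:
  fixes f :: "real \<Rightarrow> real \<Rightarrow> real"
  assumes "0 \<le> \<tau>" and "0 < L"
    and cont: "continuous_on ({0..\<tau>} \<times> UNIV) (\<lambda>p. f (fst p) (snd p))"
    and lip: "\<And>t x y. t \<in> {0..\<tau>} \<Longrightarrow> \<bar>f t x - f t y\<bar> \<le> L * \<bar>x - y\<bar>"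
  obtains X where "X 0 = x0" "\<And>t. t \<in> {0..\<tau>} \<Longrightarrow> (X has_real_derivative f t (X t)) (at t within {0..\<tau>})"
proof -
  \<comment> \<open>Clamping time extends functions on \<open>{0..\<tau>}\<close> to bounded
    continuous functions on the line, a complete type to which Banach's theorem applies.\<close>
  define cl where "cl = (\<lambda>t. max 0 (min \<tau> t))"
  have cl: "cl t \<in> {0..\<tau>}" for t using \<open>0 \<le> \<tau>\<close> by (auto simp: cl_def)
  have cl_id: "cl t = t" if "t \<in> {0..\<tau>}" for t using that by (auto simp: cl_def)
  define g where "g = (\<lambda>(\<phi> :: real \<Rightarrow>\<^sub>C real) s. f s (x0 + exp (2 * L * s) * \<phi> s))"
  have g_cont: "continuous_on {0..\<tau>} (g \<phi>)" for \<phi>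
  proof -
    have "continuous_on {0..\<tau>} (\<lambda>s. (\<lambda>p. f (fst p) (snd p)) (s, x0 + exp (2 * L * s) * \<phi> s))"
      by (rule continuous_on_compose2[OF cont]) (auto intro!: continuous_intros)
    then show ?thesis by (simp add: g_def)
  qed
  have g_int: "g \<phi> integrable_on {0..s}" if "s \<in> {0..\<tau>}" for \<phi> s
    by (rule integrable_continuous_real, rule continuous_on_subset[OF g_cont]) (use that in auto)
  \<comment> \<open>the exponential weight makes the Picard map a contraction on the whole interval at once\<close>
  define J where "J = (\<lambda>\<phi> s. exp (- 2 * L * s) * integral {0..s} (g \<phi>))"
  have J_cont: "continuous_on {0..\<tau>} (J \<phi>)" for \<phi>
    unfolding J_def by (intro continuous_intros indefinite_integral_continuous_1 g_int) (use \<open>0 \<le> \<tau>\<close> in auto)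
  have J_bcont: "(\<lambda>t. J \<phi> (cl t)) \<in> bcontfun" for \<phi>
  proof -
    have "continuous_on UNIV (\<lambda>t. J \<phi> (cl t))"
      by (rule continuous_on_compose2[OF J_cont]) (use cl in \<open>auto simp: cl_def intro!: continuous_intros\<close>)
    moreover have "bounded (range (\<lambda>t. J \<phi> (cl t)))"
      by (rule bounded_subset[OF compact_imp_bounded[OF compact_continuous_image[OF J_cont]]])
        (use cl in auto)
    ultimately show ?thesis by (simp add: bcontfun_def)
  qed
  define P where "P = (\<lambda>\<phi>. Bcontfun (\<lambda>t. J \<phi> (cl t)))"
  have P: "apply_bcontfun (P \<phi>) t = J \<phi> (cl t)" for \<phi> t
    by (simp add: P_def Bcontfun_inverse[OF J_bcont])
  have contr: "dist (P \<phi>) (P \<psi>) \<le> 1 / 2 * dist \<phi> \<psi>" for \<phi> \<psi>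
  proof (rule dist_bound)
    fix t
    define s where "s = cl t"
    define d where "d = dist \<phi> \<psi>"
    have s: "s \<in> {0..\<tau>}" using cl by (simp add: s_def)
    have d: "0 \<le> d" by (simp add: d_def)
    have E: "((\<lambda>r. d * L * exp (2 * L * r)) has_integral (d / 2 * exp (2 * L * s) - d / 2 * exp (2 * L * 0))) {0..s}"
      using s \<open>0 < L\<close>
      by (intro fundamental_theorem_of_calculus)
        (auto intro!: derivative_eq_intros simp flip: has_real_derivative_iff_has_vector_derivative)
    have "norm (integral {0..s} (\<lambda>r. g \<phi> r - g \<psi> r)) \<le> integral {0..s} (\<lambda>r. d * L * exp (2 * L * r))"
    proof (rule integral_norm_bound_integral)
      show "(\<lambda>r. g \<phi> r - g \<psi> r) integrable_on {0..s}"
        by (intro integrable_diff g_int s)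
      show "(\<lambda>r. d * L * exp (2 * L * r)) integrable_on {0..s}" using E by blast
      fix r assume r: "r \<in> {0..s}"
      then have "\<bar>g \<phi> r - g \<psi> r\<bar> \<le> L * \<bar>(x0 + exp (2 * L * r) * \<phi> r) - (x0 + exp (2 * L * r) * \<psi> r)\<bar>"
        unfolding g_def using s by (intro lip) auto
      also have "\<dots> = L * (exp (2 * L * r) * \<bar>\<phi> r - \<psi> r\<bar>)"
        by (simp add: abs_mult flip: right_diff_distrib)
      also have "\<dots> \<le> L * (exp (2 * L * r) * d)"
        using \<open>0 < L\<close> dist_bounded[of \<phi> r \<psi>] by (intro mult_left_mono) (auto simp: d_def dist_real_def)
      finally show "norm (g \<phi> r - g \<psi> r) \<le> d * L * exp (2 * L * r)" by (simp add: mult_ac)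
    qed
    also have "\<dots> = d / 2 * exp (2 * L * s) - d / 2" using integral_unique[OF E] by simp
    also have "\<dots> \<le> d / 2 * exp (2 * L * s)" using d by simp
    finally have I: "\<bar>integral {0..s} (g \<phi>) - integral {0..s} (g \<psi>)\<bar> \<le> d / 2 * exp (2 * L * s)"
      using integral_diff[OF g_int[OF s] g_int[OF s]] by simp
    have "dist (P \<phi> t) (P \<psi> t) = exp (- 2 * L * s) * \<bar>integral {0..s} (g \<phi>) - integral {0..s} (g \<psi>)\<bar>"
      by (simp add: P J_def dist_real_def abs_mult flip: right_diff_distrib s_def)
    also have "\<dots> \<le> exp (- 2 * L * s) * (d / 2 * exp (2 * L * s))"
      using I by (intro mult_left_mono) auto
    also have "\<dots> = d / 2" by (simp add: exp_minus)
    finally show "dist (P \<phi> t) (P \<psi> t) \<le> 1 / 2 * dist \<phi> \<psi>" by (simp add: d_def)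
  qed
  then obtain \<phi> where \<phi>: "P \<phi> = \<phi>"
    using banach_fix_type[of "1 / 2" P] by auto
  define X where "X = (\<lambda>t. x0 + integral {0..t} (g \<phi>))"
  have X: "X t = x0 + exp (2 * L * t) * \<phi> t" if "t \<in> {0..\<tau>}" for t
  proof -
    have "\<phi> t = J \<phi> t" using P[of \<phi> t] \<phi> cl_id[OF that] by simp
    then show ?thesis by (simp add: X_def J_def exp_minus)
  qed
  show ?thesis
  proof (rule that)
    show "X 0 = x0" by (simp add: X_def)
    fix t assume t: "t \<in> {0..\<tau>}"
    have "(X has_real_derivative g \<phi> t) (at t within {0..\<tau>})"
      unfolding X_def
      using DERIV_add[OF DERIV_const integral_has_real_derivative[OF g_cont t], of x0] by simp
    then show "(X has_real_derivative f t (X t)) (at t within {0..\<tau>})"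
      by (simp add: g_def X[OF t])
  qed
qed

text \<open>For solutions that are only \<open>C\<^sup>1\<close> the slope \<open>w\<^sub>x\<close> cannot be differentiated directly. It is the limit
  of difference quotients between the characteristic and its parallel translates, for which the
  transport equation can be integrated in time.\<close>

lemma slope_along_characteristic:
  assumes "0 \<le> \<tau>"
    and w: "has_gradient_on {0..\<tau>} w (\<lambda>t x. b t x * wx t x + F t x) wx"
    and b: "\<And>t x. t \<in> {0..\<tau>} \<Longrightarrow> (b t has_real_derivative bx t x) (at x)"
    and F: "\<And>t x. t \<in> {0..\<tau>} \<Longrightarrow> (F t has_real_derivative Fx t x) (at x)"
    and wx_cont: "continuous_on ({0..\<tau>} \<times> UNIV) (\<lambda>p. wx (fst p) (snd p))"
    and bx_cont: "continuous_on ({0..\<tau>} \<times> UNIV) (\<lambda>p. bx (fst p) (snd p))"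
    and Fx_cont: "continuous_on ({0..\<tau>} \<times> UNIV) (\<lambda>p. Fx (fst p) (snd p))"
    and bound: "\<And>t x. t \<in> {0..\<tau>} \<Longrightarrow> \<bar>wx t x\<bar> \<le> B \<and> \<bar>bx t x\<bar> \<le> B \<and> \<bar>Fx t x\<bar> \<le> B"
    and X: "\<And>t. t \<in> {0..\<tau>} \<Longrightarrow> (X has_real_derivative - b t (X t)) (at t within {0..\<tau>})"
    and t: "t \<in> {0..\<tau>}"
  shows "((\<lambda>t. wx t (X t)) has_real_derivative bx t (X t) * wx t (X t) + Fx t (X t)) (at t within {0..\<tau>})"
proof -
  have X_cont: "continuous_on {0..\<tau>} X"
    by (rule DERIV_continuous_on) (rule X)
  define g where "g = (\<lambda>t. bx t (X t) * wx t (X t) + Fx t (X t))"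
  have comp_cont: "continuous_on {0..\<tau>} (\<lambda>t. z t (X t))"
    if "continuous_on ({0..\<tau>} \<times> UNIV) (\<lambda>p. z (fst p) (snd p))" for z
  proof -
    have "continuous_on {0..\<tau>} (\<lambda>t. (t, X t))" by (intro continuous_intros X_cont)
    from continuous_on_compose2[OF that this] show ?thesis by auto
  qed
  have g_cont: "continuous_on {0..\<tau>} g"
    unfolding g_def by (intro continuous_intros comp_cont bx_cont wx_cont Fx_cont)
  define h where "h = (\<lambda>n. inverse (real (Suc n)))"
  have h_pos: "h n > 0" for n by (simp add: h_def)
  have h_lim: "h \<longlonglongrightarrow> 0" unfolding h_def by (rule LIMSEQ_inverse_real_of_nat)
  have h_at: "filterlim h (at 0) sequentially"
    unfolding filterlim_at using h_lim h_pos by (auto simp: less_imp_neq[THEN not_sym])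
  have quot_lim: "(\<lambda>n. (k (y + h n) - k y) / h n) \<longlonglongrightarrow> k'" if "(k has_real_derivative k') (at y)" for k k' y
    using that unfolding DERIV_def by (rule filterlim_compose) (rule h_at)
  have quot_bound: "\<bar>(k (y + h n) - k y) / h n\<bar> \<le> B"
    if "\<And>y. (k has_real_derivative k' y) (at y)" "\<And>y. \<bar>k' y\<bar> \<le> B" for k k' y n
  proof -
    have "norm (k (y + h n) - k y) \<le> B * norm (y + h n - y)"
      by (rule field_differentiable_bound[of UNIV k k']) (use that in auto)
    then show ?thesis using h_pos[of n] by (simp add: field_simps)
  qed
  define q where "q = (\<lambda>n t. (w t (X t + h n) - w t (X t)) / h n)"
  \<comment> \<open>The translate moves with the speed at \<open>X t\<close>, not at
    \<open>X t + h n\<close>. The mismatch, divided by \<open>h n\<close>, is a difference quotient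
    of \<open>b\<close>, so no second derivative of \<open>w\<close> appears.\<close>
  define q' where "q' = (\<lambda>n t. (b t (X t + h n) - b t (X t)) / h n * wx t (X t + h n) + (F t (X t + h n) - F t (X t)) / h n)"
  have q: "(q n has_real_derivative q' n s) (at s within {0..\<tau>})" if s: "s \<in> {0..\<tau>}" for n s
  proof -
    have 1: "((\<lambda>t. w t (X t)) has_real_derivative (b s (X s) * wx s (X s) + F s (X s)) * 1 + wx s (X s) * (- b s (X s))) (at s within {0..\<tau>})"
      using s by (intro has_gradient_on_along[OF w] X) auto
    have 2: "((\<lambda>t. w t (X t + h n)) has_real_derivative (b s (X s + h n) * wx s (X s + h n) + F s (X s + h n)) * 1
        + wx s (X s + h n) * (- b s (X s))) (at s within {0..\<tau>})"
      using s by (intro has_gradient_on_along[OF w]) (auto intro!: derivative_eq_intros X)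
    from DERIV_cdivide[OF DERIV_diff[OF 2 1], of "h n"] show ?thesis
      unfolding q_def q'_def by (rule DERIV_cong) (use h_pos[of n] in \<open>simp add: field_simps\<close>)
  qed
  have q_int: "(q' n has_integral q n t - q n 0) {0..t}" if t: "t \<in> {0..\<tau>}" for n t
  proof (rule fundamental_theorem_of_calculus)
    show "0 \<le> t" using t by simp
    fix s assume "s \<in> {0..t}"
    then have "(q n has_real_derivative q' n s) (at s within {0..t})"
      using t by (intro DERIV_subset[OF q]) auto
    then show "(q n has_vector_derivative q' n s) (at s within {0..t})"
      by (simp add: has_real_derivative_iff_has_vector_derivative)
  qed
  have q_lim: "(\<lambda>n. q n t) \<longlonglongrightarrow> wx t (X t)" if "t \<in> {0..\<tau>}" for t
    unfolding q_def by (rule quot_lim[OF has_gradient_on_snd[OF w that]])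
  have q'_lim: "(\<lambda>n. q' n t) \<longlonglongrightarrow> g t" if t: "t \<in> {0..\<tau>}" for t
  proof -
    have "continuous_on UNIV (\<lambda>x. (t, x))" by (intro continuous_intros)
    moreover have "range (\<lambda>x. (t, x)) \<subseteq> {0..\<tau>} \<times> UNIV" using t by blast
    ultimately have "continuous_on UNIV (\<lambda>x. wx t x)"
      using continuous_on_compose2[OF wx_cont, of UNIV "\<lambda>x. (t, x)"] by simp
    moreover have "(\<lambda>n. X t + h n) \<longlonglongrightarrow> X t + 0" by (intro tendsto_intros h_lim)
    ultimately have "(\<lambda>n. wx t (X t + h n)) \<longlonglongrightarrow> wx t (X t)"
      by (auto simp: continuous_on_eq_continuous_at intro: isCont_tendsto_compose)
    then show ?thesis
      unfolding q'_def g_def by (intro tendsto_intros quot_lim b F t)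
  qed
  have q'_bound: "norm (q' n t) \<le> B * B + B" if t: "t \<in> {0..\<tau>}" for n t
  proof -
    have 1: "\<bar>(b t (X t + h n) - b t (X t)) / h n\<bar> \<le> B"
      by (rule quot_bound) (use b bound t in auto)
    have 2: "\<bar>(F t (X t + h n) - F t (X t)) / h n\<bar> \<le> B"
      by (rule quot_bound) (use F bound t in auto)
    have "\<bar>(b t (X t + h n) - b t (X t)) / h n * wx t (X t + h n)\<bar> \<le> B * B"
      unfolding abs_mult by (intro mult_mono 1) (use bound[OF t] 1 in \<open>auto intro: order_trans[OF abs_ge_zero]\<close>)
    with 2 show ?thesis unfolding q'_def real_norm_def by linarith
  qed
  \<comment> \<open>Convergence of the \<open>q' n\<close> is only pointwise with a common bound, so
    the limit is taken in the integrated equation. Continuity of \<open>g\<close> then permits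
    differentiating the result.\<close>
  have eq: "wx t (X t) = wx 0 (X 0) + integral {0..t} g" if t: "t \<in> {0..\<tau>}" for t
  proof -
    have "(\<lambda>n. integral {0..t} (q' n)) \<longlonglongrightarrow> integral {0..t} g"
    proof (rule dominated_convergence)
      show "q' n integrable_on {0..t}" for n using q_int[OF t] by blast
      show "(\<lambda>_. B * B + B) integrable_on {0..t}" by (rule integrable_const_ivl)
      show "norm (q' n s) \<le> B * B + B" if "s \<in> {0..t}" for n s
        using that t by (intro q'_bound) auto
      show "(\<lambda>n. q' n s) \<longlonglongrightarrow> g s" if "s \<in> {0..t}" for s
        using that t by (intro q'_lim) auto
    qed
    moreover have "integral {0..t} (q' n) = q n t - q n 0" for n
      using q_int[OF t] by (rule integral_unique)
    moreover have "(\<lambda>n. q n t - q n 0) \<longlonglongrightarrow> wx t (X t) - wx 0 (X 0)"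
      using t by (intro tendsto_diff q_lim) auto
    ultimately have "integral {0..t} g = wx t (X t) - wx 0 (X 0)"
      by (simp add: LIMSEQ_unique)
    then show ?thesis by simp
  qed
  have "((\<lambda>t. wx 0 (X 0) + integral {0..t} g) has_real_derivative g t) (at t within {0..\<tau>})"
    using DERIV_add[OF DERIV_const integral_has_real_derivative[OF g_cont t], of "wx 0 (X 0)"] by simp
  then have "((\<lambda>t. wx t (X t)) has_real_derivative g t) (at t within {0..\<tau>})"
    by (rule has_field_derivative_transform_within[of _ _ _ _ 1])
      (use t in \<open>simp_all add: eq[symmetric]\<close>)
  then show ?thesis by (simp add: g_def)
qed

subsection \<open>Riccati inequalities\<close>

text \<open>\<open>Z\<close> is strictly decreasing wherever it is at most \<open>- K\<close>, so it
  never leaves that region. There 1/Z grows at rate at least \<open>k\<close>; it starts at or above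
  -1/K and has to stay negative.\<close>

lemma riccati_time_bound:
  assumes Z: "\<And>t. t \<in> {0..\<tau>} \<Longrightarrow> (Z has_real_derivative Z' t) (at t within {0..\<tau>})"
    and Z': "\<And>t. t \<in> {0..\<tau>} \<Longrightarrow> Z t \<le> - K \<Longrightarrow> Z' t \<le> - k * (Z t)\<^sup>2"
    and "0 < k" "0 < K" "Z 0 \<le> - K" "0 \<le> \<tau>"
  shows "\<tau> * (k * K) \<le> 1"
proof -
  have cont: "continuous_on {0..\<tau>} Z"
    by (rule DERIV_continuous_on) (rule Z)
  have stay: "Z t \<le> - K" if t: "t \<in> {0..\<tau>}" for t
  proof (rule ccontr)
    assume neg: "\<not> Z t \<le> - K"
    \<comment> \<open>The last time up to \<open>t\<close> at which \<open>Z\<close> is still at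
      most \<open>- K\<close> exists by compactness; strict decrease just after it produces a later
      one.\<close>
    define S where "S = {s \<in> {0..t}. Z s \<le> - K}"
    have "closed ({0..t} \<inter> Z -` {..- K})"
      by (rule continuous_closed_preimage[OF continuous_on_subset[OF cont]]) (use t in auto)
    also have "{0..t} \<inter> Z -` {..- K} = S" by (auto simp: S_def)
    finally have "closed S" .
    moreover have "bounded S" by (rule bounded_subset[of "{0..t}"]) (auto simp: S_def)
    ultimately have "compact S" by (simp add: compact_eq_bounded_closed)
    moreover have "0 \<in> S" using t assms(5) by (auto simp: S_def)
    ultimately obtain s where s: "s \<in> S" "\<And>r. r \<in> S \<Longrightarrow> r \<le> s"
      using compact_attains_sup[of S] by auto
    have st: "s \<in> {0..\<tau>}" "s < t" "Z s \<le> - K" using s(1) t neg by (auto simp: S_def less_le)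
    have "Z s \<noteq> 0" using st(3) \<open>0 < K\<close> by auto
    then have "- k * (Z s)\<^sup>2 < 0" using \<open>0 < k\<close> by simp
    with Z'[OF st(1,3)] have "Z' s < 0" by linarith
    from has_real_derivative_neg_dec_right[OF Z[OF st(1)] this]
    obtain d where d: "d > 0" "\<And>h. h > 0 \<Longrightarrow> s + h \<in> {0..\<tau>} \<Longrightarrow> h < d \<Longrightarrow> Z (s + h) < Z s" by auto
    define h where "h = min (d / 2) (t - s)"
    have h: "h > 0" "h < d" "h \<le> t - s" using d(1) st(2) by (auto simp: h_def)
    then have "s + h \<in> S" using d(2)[of h] st t by (auto simp: S_def)
    with s(2) h(1) show False by fastforce
  qed
  have nz: "Z t \<noteq> 0" if "t \<in> {0..\<tau>}" for t using stay[OF that] \<open>0 < K\<close> by auto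
  have "\<exists>t\<in>{0..\<tau>}. inverse (Z \<tau>) - inverse (Z 0) = (- (inverse (Z t) * Z' t * inverse (Z t))) * (\<tau> - 0)"
    by (rule mvt_very_simple[OF \<open>0 \<le> \<tau>\<close>, where f' = "\<lambda>t. (*) (- (inverse (Z t) * Z' t * inverse (Z t)))"])
      (use DERIV_inverse'[OF Z nz] in \<open>auto simp: has_field_derivative_def\<close>)
  then obtain t where t: "t \<in> {0..\<tau>}"
    "inverse (Z \<tau>) - inverse (Z 0) = (- (inverse (Z t) * Z' t * inverse (Z t))) * \<tau>" by auto
  have "k \<le> - (inverse (Z t) * Z' t * inverse (Z t))"
  proof -
    have "0 < (Z t)\<^sup>2" using nz[OF t(1)] by simp
    moreover have "k * (Z t)\<^sup>2 \<le> - Z' t" using Z'[OF t(1) stay[OF t(1)]] by simp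
    ultimately have "k \<le> - Z' t / (Z t)\<^sup>2" by (subst pos_le_divide_eq)
    then show ?thesis by (simp add: power2_eq_square field_simps)
  qed
  then have "k * \<tau> \<le> inverse (Z \<tau>) - inverse (Z 0)"
    unfolding t(2) using \<open>0 \<le> \<tau>\<close> by (rule mult_right_mono)
  moreover have "inverse (Z \<tau>) < 0" using stay[of \<tau>] \<open>0 \<le> \<tau>\<close> \<open>0 < K\<close> by simp
  moreover have "- inverse (Z 0) \<le> inverse K"
    using le_imp_inverse_le[of K "- Z 0"] \<open>Z 0 \<le> - K\<close> \<open>0 < K\<close> by simp
  ultimately have "k * \<tau> \<le> inverse K" by linarith
  then have "k * \<tau> * K \<le> inverse K * K" using \<open>0 < K\<close> by (intro mult_right_mono) auto
  then show ?thesis using \<open>0 < K\<close> by (simp add: mult_ac)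
qed

text \<open>Here \<open>y\<close> stands for the weighted slope and \<open>A * P\<close> for the
  size of the correction. The part \<open>1 + 2 * A * P\<close> of \<open>K\<close> gives y <= Z / 2
  and - y >= A P. The part \<open>4 * (A + 1) / \<kappa>\<close> gives \<kappa> y / 2 + A <= -1, and
  multiplying by the negative \<open>y\<close> shows that half of the quadratic term pays for all
  lower-order terms. The other half is at least \<kappa> / 2 times (Z / 2)^2, which is where
  \<kappa> / 8 comes from.\<close>

lemma riccati_absorb:
  fixes y Z :: real
  assumes "0 < \<kappa>" "0 \<le> A" "0 \<le> P" and K: "K = 1 + 2 * A * P + 4 * (A + 1) / \<kappa>"
    and Z: "Z \<le> - K" and y: "y \<le> Z + A * P"
    and a: "0 \<le> a" "a \<le> A" and d: "d \<le> A * P" and \<rho>: "\<kappa> \<le> \<rho>"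
  shows "- \<rho> * y\<^sup>2 - a / 2 * y + d \<le> - (\<kappa> / 8) * Z\<^sup>2"
proof -
  have AP: "0 \<le> A * P" using assms by simp
  have q: "0 < 4 * (A + 1) / \<kappa>" using assms by simp
  have K': "1 + 2 * (A * P) \<le> K" "4 * (A + 1) / \<kappa> \<le> K" using K AP q by auto
  have yZ: "y \<le> Z / 2" using y Z K' AP by linarith
  have yK: "y \<le> - K / 2" using yZ Z by linarith
  have neg: "y < 0" "Z < 0" using yZ Z K' AP by linarith+
  have "(Z / 2)\<^sup>2 \<le> y\<^sup>2"
    using yZ neg by (simp add: abs_le_square_iff[symmetric])
  then have 1: "\<kappa> / 8 * Z\<^sup>2 \<le> \<kappa> / 2 * y\<^sup>2"
    using mult_left_mono[of "(Z / 2)\<^sup>2" "y\<^sup>2" "\<kappa> / 2"] \<open>0 < \<kappa>\<close> by (simp add: power_divide)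
  have 2: "\<kappa> * y\<^sup>2 \<le> \<rho> * y\<^sup>2" using \<rho> by (simp add: mult_right_mono)
  have 3: "- (a / 2 * y) \<le> - (A * y)"
  proof -
    have "a / 2 * (- y) \<le> A * (- y)" using a neg by (intro mult_right_mono) auto
    then show ?thesis by simp
  qed
  have "4 * (A + 1) \<le> K * \<kappa>" using K'(2) \<open>0 < \<kappa>\<close> by (simp add: pos_divide_le_eq)
  moreover have "\<kappa> * y \<le> \<kappa> * (- K / 2)" using yK \<open>0 < \<kappa>\<close> by (intro mult_left_mono) auto
  ultimately have "\<kappa> / 2 * y + A \<le> - 1" by (simp add: mult.commute)
  from mult_right_mono_neg[OF this, of y] neg have "- y \<le> (\<kappa> / 2 * y + A) * y" by simp
  then have "A * P \<le> \<kappa> / 2 * y\<^sup>2 + A * y"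
    using yK K' AP by (simp add: power2_eq_square algebra_simps)
  with 1 2 3 d show ?thesis by linarith
qed

subsection \<open>The sound speed\<close>

text \<open>The square root of \<open>wave_speed\<close> at positive arguments, used as the weight
  of the slopes.\<close>

definition sqrt_speed :: "real \<Rightarrow> real \<Rightarrow> real" where
  "sqrt_speed \<gamma> z = z powr (- ((\<gamma> + 1) / 4))"

definition sqrt_speed' :: "real \<Rightarrow> real \<Rightarrow> real" where
  "sqrt_speed' \<gamma> z = - ((\<gamma> + 1) / 4) * z powr (- ((\<gamma> + 1) / 4) - 1)"

lemma sqrt_speed_deriv: "z > 0 \<Longrightarrow> (sqrt_speed \<gamma> has_real_derivative sqrt_speed' \<gamma> z) (at z)"
  unfolding sqrt_speed_def[abs_def] sqrt_speed'_def by (rule has_real_derivative_powr)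

lemma sqrt_speed_pos: "z > 0 \<Longrightarrow> sqrt_speed \<gamma> z > 0"
  by (simp add: sqrt_speed_def)

text \<open>Rewrites the term \<open>sqrt_speed'\<close> times w_x^2 as a negative multiple of the
  square of the weighted slope, exposing the Riccati coefficient.\<close>

lemma sqrt_speed'_eq:
  assumes "z > 0"
  shows "sqrt_speed' \<gamma> z = - ((\<gamma> + 1) / 4 * z powr ((\<gamma> + 1) / 4 - 1)) * (sqrt_speed \<gamma> z)\<^sup>2"
proof -
  have "z powr (- ((\<gamma> + 1) / 4) - 1) = z powr ((\<gamma> + 1) / 4 - 1) * (sqrt_speed \<gamma> z)\<^sup>2"
    unfolding sqrt_speed_def power2_eq_square powr_add[symmetric] by (simp add: algebra_simps)
  then show ?thesis by (simp add: sqrt_speed'_def)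
qed

lemma continuous_on_sqrt_speed: "continuous_on {0<..} (sqrt_speed \<gamma>)"
  by (rule DERIV_continuous_on) (auto intro!: DERIV_subset[OF sqrt_speed_deriv])

lemma continuous_on_sqrt_speed': "continuous_on {0<..} (sqrt_speed' \<gamma>)"
  unfolding sqrt_speed'_def by (intro continuous_intros) auto

lemma wave_speed_eq_square:
  assumes "\<gamma> > 1" "z > 0"
  shows "wave_speed \<gamma> z = (sqrt_speed \<gamma> z)\<^sup>2"
proof -
  have "- ((\<gamma> + 1) / 2) = - ((\<gamma> + 1) / 4) + - ((\<gamma> + 1) / 4)" by (simp add: field_simps)
  then show ?thesis
    by (simp only: wave_speed_eq[OF assms] sqrt_speed_def power2_eq_square powr_add)
qed

lemma wave_speed_square:
  assumes "\<gamma> > 1" "z > 0"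
  shows "(wave_speed \<gamma> z)\<^sup>2 = z powr (- \<gamma> - 1)"
proof -
  have "- \<gamma> - 1 = - ((\<gamma> + 1) / 2) + - ((\<gamma> + 1) / 2)" by (simp add: field_simps)
  then show ?thesis
    by (simp only: wave_speed_eq[OF assms] power2_eq_square powr_add)
qed

lemma wave_speed_pos: "\<gamma> > 1 \<Longrightarrow> z > 0 \<Longrightarrow> wave_speed \<gamma> z > 0"
  by (simp add: wave_speed_eq)

lemma wave_speed_antimono:
  assumes "\<gamma> > 1" "0 < x" "x \<le> y"
  shows "wave_speed \<gamma> y \<le> wave_speed \<gamma> x"
  using assms powr_mono2'[of "- ((\<gamma> + 1) / 2)" x y] by (simp add: wave_speed_eq)

lemma wave_speed_deriv:
  assumes "\<gamma> > 1" "z > 0"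
  shows "(wave_speed \<gamma> has_real_derivative 2 * sqrt_speed \<gamma> z * sqrt_speed' \<gamma> z) (at z)"
proof (rule has_field_derivative_transform_within_open)
  show "((\<lambda>z. (sqrt_speed \<gamma> z)\<^sup>2) has_real_derivative 2 * sqrt_speed \<gamma> z * sqrt_speed' \<gamma> z) (at z)"
    using sqrt_speed_deriv[OF assms(2)] by (auto intro!: derivative_eq_intros)
qed (use assms wave_speed_eq_square in \<open>auto intro: open_greaterThan[of 0]\<close>)

lemma eta_deriv:
  assumes "\<gamma> > 1" "z > 0"
  shows "(eta \<gamma> has_real_derivative - wave_speed \<gamma> z) (at z)"
proof (rule has_field_derivative_transform_within_open)
  have 1: "((\<lambda>z. z powr (- ((\<gamma> - 1) / 2))) has_real_derivative
      - ((\<gamma> - 1) / 2) * z powr (- ((\<gamma> - 1) / 2) - 1)) (at z)"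
    using assms(2) by (rule has_real_derivative_powr)
  have "- ((\<gamma> - 1) / 2) - 1 = - ((\<gamma> + 1) / 2)" by (simp add: field_simps)
  with DERIV_cmult[OF 1, of "2 / (\<gamma> - 1)"] assms
  show "((\<lambda>z. 2 / (\<gamma> - 1) * z powr (- ((\<gamma> - 1) / 2))) has_real_derivative - wave_speed \<gamma> z) (at z)"
    by (simp add: wave_speed_eq)
qed (use assms eta_eq in \<open>auto intro: open_greaterThan[of 0]\<close>)

lemma eta_pos: "\<gamma> > 1 \<Longrightarrow> z > 0 \<Longrightarrow> eta \<gamma> z > 0"
  by (simp add: eta_eq)

lemma eta_antimono:
  assumes "\<gamma> > 1" "0 < x" "x \<le> y"
  shows "eta \<gamma> y \<le> eta \<gamma> x"
  using assms powr_mono2'[of "- ((\<gamma> - 1) / 2)" x y] by (simp add: eta_eq divide_right_mono)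

lemma eta_strict_antimono:
  assumes "\<gamma> > 1" "0 < x" "x < y"
  shows "eta \<gamma> y < eta \<gamma> x"
  using assms powr_less_mono2_neg[of "- ((\<gamma> - 1) / 2)" x y] by (simp add: eta_eq divide_strict_right_mono)

text \<open>The invariants control \<open>eta\<close> of the density variable; this supplies the
  endpoints that turn such control into bounds on \<open>u\<close>.\<close>

lemma eta_surj:
  assumes "\<gamma> > 1" "0 < y"
  obtains z where "0 < z" "eta \<gamma> z = y"
proof
  define q where "q = (\<gamma> - 1) / 2"
  define z where "z = (q * y) powr (- (1 / q))"
  have q: "q > 0" "2 / (\<gamma> - 1) = 1 / q" using assms by (auto simp: q_def)
  show z: "0 < z" using assms q by (simp add: z_def)
  have "z powr (- q) = q * y" using q assms by (simp add: z_def powr_powr)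
  then show "eta \<gamma> z = y" using q by (simp add: eta_eq[OF assms(1) z] flip: q_def)
qed

text \<open>At \<open>\<gamma> = 3\<close> the exponent is -1 and the antiderivative is a logarithm.
  Only the derivative of \<open>\<Phi>\<close> is handed on, so later arguments treat both cases
  alike and see \<open>\<Phi>\<close> merely as bounded on compact intervals.\<close>

lemma sqrt_speed_antiderivative:
  obtains \<Phi> where "\<And>z. z > 0 \<Longrightarrow> (\<Phi> has_real_derivative sqrt_speed \<gamma> z) (at z)"
proof (cases "\<gamma> = 3")
  case True
  have "(ln has_real_derivative sqrt_speed \<gamma> z) (at z)" if "z > 0" for z
    using DERIV_ln[OF that] that by (simp add: True sqrt_speed_def powr_minus)
  then show ?thesis by (rule that)
next
  case False
  define k where "k = 1 - (\<gamma> + 1) / 4"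
  have k: "k \<noteq> 0" "k - 1 = - ((\<gamma> + 1) / 4)" using False by (auto simp: k_def field_simps)
  have "((\<lambda>z. z powr k / k) has_real_derivative sqrt_speed \<gamma> z) (at z)" if "z > 0" for z
    using DERIV_cdivide[OF has_real_derivative_powr[OF that, of k], of k] k by (simp add: sqrt_speed_def)
  then show ?thesis by (rule that)
qed

subsection \<open>The damped p-system on a strip\<close>

text \<open>The equations sit in the time slots of \<open>u_grad\<close> and \<open>v_grad\<close>,
  with p' = - c^2, so no time derivative remains as a separate object. \<open>l\<close> and
  \<open>B\<close> are the solution's own bounds, not the uniform ones.\<close>

locale damped_p_system =
  fixes \<gamma> T l B :: real and a :: "real \<Rightarrow> real" and u v ux vx :: "real \<Rightarrow> real \<Rightarrow> real"
  assumes \<gamma>: "\<gamma> > 1"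
    and damping_nonneg: "\<And>t. 0 \<le> t \<Longrightarrow> 0 \<le> a t"
    and damping_cont: "continuous_on {0..} a"
    and u_grad: "has_gradient_on {0..<T} u vx ux"
    and v_grad: "has_gradient_on {0..<T} v (\<lambda>t x. (wave_speed \<gamma> (u t x))\<^sup>2 * ux t x - a t * v t x) vx"
    and ux_cont: "continuous_on ({0..<T} \<times> UNIV) (\<lambda>p. ux (fst p) (snd p))"
    and vx_cont: "continuous_on ({0..<T} \<times> UNIV) (\<lambda>p. vx (fst p) (snd p))"
    and l: "l > 0" "\<And>t x. t \<in> {0..<T} \<Longrightarrow> l \<le> u t x"
    and u_upper: "\<And>t x. t \<in> {0..<T} \<Longrightarrow> u t x \<le> B"
    and slope_bound: "\<And>t x. t \<in> {0..<T} \<Longrightarrow> \<bar>ux t x\<bar> \<le> B \<and> \<bar>vx t x\<bar> \<le> B"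
begin

lemma u_pos: "t \<in> {0..<T} \<Longrightarrow> 0 < u t x"
  using l by (meson less_le_trans)

text \<open>The sign \<open>\<theta> = 1\<close> gives the invariant \<open>r\<close>, and \<open>\<theta> = - 1\<close> gives \<open>s\<close>.\<close>

definition riemann_inv :: "real \<Rightarrow> real \<Rightarrow> real \<Rightarrow> real" where
  "riemann_inv \<theta> t x = v t x - \<theta> * eta \<gamma> (u t x)"

definition riemann_inv_x :: "real \<Rightarrow> real \<Rightarrow> real \<Rightarrow> real" where
  "riemann_inv_x \<theta> t x = vx t x + \<theta> * wave_speed \<gamma> (u t x) * ux t x"

text \<open>Diagonalisation: as \<theta>^2 = 1, the term c^2 u_x is \<theta> c times \<theta> c u_x,
  so only the invariant's own slope survives, transported with velocity - \<theta> c.\<close>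

lemma riemann_inv_gradient:
  assumes \<theta>: "\<theta> * \<theta> = 1"
  shows "has_gradient_on {0..<T} (riemann_inv \<theta>)
    (\<lambda>t x. \<theta> * wave_speed \<gamma> (u t x) * riemann_inv_x \<theta> t x + (- (a t) * v t x)) (riemann_inv_x \<theta>)"
proof -
  have "has_gradient_on {0..<T} (\<lambda>t x. - \<theta> * eta \<gamma> (u t x))
      (\<lambda>t x. (- \<theta> * - wave_speed \<gamma> (u t x)) * vx t x) (\<lambda>t x. (- \<theta> * - wave_speed \<gamma> (u t x)) * ux t x)"
    by (rule has_gradient_on_compose[OF u_grad, where h = "\<lambda>z. - \<theta> * eta \<gamma> z"])
      (intro DERIV_cmult eta_deriv \<gamma> u_pos)
  from has_gradient_on_add[OF v_grad this]
  have "has_gradient_on {0..<T} (\<lambda>t x. v t x + - \<theta> * eta \<gamma> (u t x))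
     (\<lambda>t x. (wave_speed \<gamma> (u t x))\<^sup>2 * ux t x - a t * v t x + - \<theta> * - wave_speed \<gamma> (u t x) * vx t x)
     (\<lambda>t x. vx t x + - \<theta> * - wave_speed \<gamma> (u t x) * ux t x)" .
  moreover have "(wave_speed \<gamma> (u t x))\<^sup>2 * ux t x - a t * v t x + - \<theta> * - wave_speed \<gamma> (u t x) * vx t x =
      \<theta> * wave_speed \<gamma> (u t x) * riemann_inv_x \<theta> t x + (- (a t) * v t x)" for t x
  proof -
    have "\<theta> * wave_speed \<gamma> (u t x) * riemann_inv_x \<theta> t x =
        \<theta> * wave_speed \<gamma> (u t x) * vx t x + (\<theta> * \<theta>) * (wave_speed \<gamma> (u t x))\<^sup>2 * ux t x"
      by (simp add: riemann_inv_x_def algebra_simps power2_eq_square)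
    then show ?thesis by (simp add: \<theta>)
  qed
  ultimately show ?thesis
    by (simp only:) (simp add: riemann_inv_def[abs_def] riemann_inv_x_def[abs_def])
qed

text \<open>With f the invariant for \<open>\<theta>\<close> and g minus the invariant for
  \<open>- \<theta>\<close>, one has 2 v = f - g, so the damping - a v is a/2 (g - f), the exchange
  form. Both signs of \<open>\<theta>\<close> are used later.\<close>

lemma riemann_inv_maximum_principle:
  assumes \<theta>: "\<theta> * \<theta> = 1" and t: "t \<in> {0..<T}"
    and init: "\<And>y. riemann_inv \<theta> 0 y \<le> k" "\<And>y. - riemann_inv (- \<theta>) 0 y \<le> k"
  shows "riemann_inv \<theta> t x \<le> k \<and> - riemann_inv (- \<theta>) t x \<le> k"
proof -
  have sub: "{0..t} \<subseteq> {0..<T}" using t by auto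
  have \<theta>': "\<bar>\<theta>\<bar> = 1" using \<theta> by (simp add: abs_square_eq_1 flip: power2_eq_square)
  have g: "has_gradient_on {0..t} (\<lambda>t x. - riemann_inv (- \<theta>) t x)
     (\<lambda>t x. - (- \<theta> * wave_speed \<gamma> (u t x) * riemann_inv_x (- \<theta>) t x + - (a t) * v t x)) (\<lambda>t x. - riemann_inv_x (- \<theta>) t x)"
    using has_gradient_on_minus[OF has_gradient_on_subset[OF riemann_inv_gradient sub], of "- \<theta>"] \<theta> by simp
  show ?thesis
  proof (rule exchange_maximum_principle[OF has_gradient_on_subset[OF riemann_inv_gradient[OF \<theta>] sub] g,
        where b = "\<lambda>t x. \<theta> * wave_speed \<gamma> (u t x)" and C = "wave_speed \<gamma> l" and \<alpha> = "\<lambda>t. a t / 2"])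
    show "\<bar>\<theta> * wave_speed \<gamma> (u s y)\<bar> \<le> wave_speed \<gamma> l" if "s \<in> {0..t}" for s y
      using wave_speed_antimono[OF \<gamma> l(1) l(2)] wave_speed_pos[OF \<gamma> u_pos] that sub
      by (subst abs_mult) (auto simp: \<theta>' abs_of_pos)
    show "0 \<le> a s / 2" if "s \<in> {0..t}" for s
      using damping_nonneg that by auto
  qed (use t init in \<open>auto simp: riemann_inv_def algebra_simps\<close>)
qed

text \<open>The multiple of the antiderivative \<open>\<Phi>\<close> of \<open>\<surd>c\<close> added to the weighted slope \<open>\<surd>c w\<^sub>x\<close> absorbs the slope of
  the other Riemann invariant, because that slope is exactly \<open>u\<^sub>t - \<theta> c u\<^sub>x\<close>.\<close>

lemma riccati_along_characteristic:
  assumes \<theta>: "\<theta> * \<theta> = 1" and \<tau>: "\<tau> \<in> {0..<T}"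
    and a: "\<And>t. t \<in> {0..\<tau>} \<Longrightarrow> (a has_real_derivative a' t) (at t)"
    and \<Phi>: "\<And>z. z > 0 \<Longrightarrow> (\<Phi> has_real_derivative sqrt_speed \<gamma> z) (at z)"
  obtains X where "X 0 = x0"
    "\<And>t. t \<in> {0..\<tau>} \<Longrightarrow>
      ((\<lambda>t. sqrt_speed \<gamma> (u t (X t)) * riemann_inv_x \<theta> t (X t) + a t / 2 * \<Phi> (u t (X t))) has_real_derivative
        sqrt_speed' \<gamma> (u t (X t)) * (riemann_inv_x \<theta> t (X t))\<^sup>2
        - a t / 2 * (sqrt_speed \<gamma> (u t (X t)) * riemann_inv_x \<theta> t (X t)) + a' t / 2 * \<Phi> (u t (X t)))
      (at t within {0..\<tau>})"
proof -
  define J where "J = {0..\<tau>} \<times> (UNIV :: real set)"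
  have sub: "{0..\<tau>} \<subseteq> {0..<T}" using \<tau> by auto
  have J: "J \<subseteq> {0..<T} \<times> UNIV" using sub by (auto simp: J_def)
  have "0 \<le> \<tau>" using \<tau> by simp
  have \<theta>': "\<bar>\<theta>\<bar> = 1" using \<theta> by (simp add: abs_square_eq_1 flip: power2_eq_square)
  note u_cont = continuous_on_subset[OF has_gradient_on_continuous[OF u_grad] J]
  note ux_cont = continuous_on_subset[OF ux_cont J]
  note vx_cont = continuous_on_subset[OF vx_cont J]
  have upos: "p \<in> J \<Longrightarrow> 0 < u (fst p) (snd p)" for p using u_pos sub by (auto simp: J_def)
  have G_cont: "continuous_on J (\<lambda>p. sqrt_speed \<gamma> (u (fst p) (snd p)))"
    by (rule continuous_on_compose2[OF continuous_on_sqrt_speed u_cont]) (use upos in auto)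
  have G'_cont: "continuous_on J (\<lambda>p. sqrt_speed' \<gamma> (u (fst p) (snd p)))"
    by (rule continuous_on_compose2[OF continuous_on_sqrt_speed' u_cont]) (use upos in auto)
  have c_cont: "continuous_on J (\<lambda>p. wave_speed \<gamma> (u (fst p) (snd p)))"
    by (rule continuous_on_eq[of _ "\<lambda>p. (sqrt_speed \<gamma> (u (fst p) (snd p)))\<^sup>2"])
      (use G_cont wave_speed_eq_square[OF \<gamma> upos] in \<open>auto intro!: continuous_intros\<close>)
  have a_cont: "continuous_on J (\<lambda>p. a (fst p))"
    by (rule continuous_on_compose2[OF damping_cont]) (auto simp: J_def intro!: continuous_intros)
  define b where "b = (\<lambda>t x. \<theta> * wave_speed \<gamma> (u t x))"
  define bx where "bx = (\<lambda>t x. \<theta> * (2 * sqrt_speed \<gamma> (u t x) * sqrt_speed' \<gamma> (u t x) * ux t x))"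
  have b: "(b t has_real_derivative bx t x) (at x)" if "t \<in> {0..\<tau>}" for t x
    unfolding b_def bx_def
    using that sub
    by (intro DERIV_cmult DERIV_chain2[where f = "wave_speed \<gamma>"] wave_speed_deriv \<gamma> u_pos has_gradient_on_snd[OF u_grad]) auto
  have bx_cont: "continuous_on J (\<lambda>p. bx (fst p) (snd p))"
    unfolding bx_def by (intro continuous_intros G_cont G'_cont ux_cont)
  have Fx_cont: "continuous_on J (\<lambda>p. - a (fst p) * vx (fst p) (snd p))"
    by (intro continuous_intros a_cont vx_cont)
  have F: "((\<lambda>x. - a t * v t x) has_real_derivative - a t * vx t x) (at x)" if "t \<in> {0..\<tau>}" for t x
    by (intro DERIV_cmult has_gradient_on_snd[OF v_grad]) (use that sub in auto)
  have wx_cont: "continuous_on J (\<lambda>p. riemann_inv_x \<theta> (fst p) (snd p))"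
    unfolding riemann_inv_x_def by (intro continuous_intros c_cont ux_cont vx_cont)
  obtain M1 where M1: "\<And>z. z \<in> {l..B} \<Longrightarrow> \<bar>2 * sqrt_speed \<gamma> z * sqrt_speed' \<gamma> z\<bar> \<le> M1"
  proof -
    have "continuous_on {l..B} (\<lambda>z. 2 * sqrt_speed \<gamma> z * sqrt_speed' \<gamma> z)"
      using l(1) by (intro continuous_intros continuous_on_subset[OF continuous_on_sqrt_speed]
          continuous_on_subset[OF continuous_on_sqrt_speed']) auto
    then have "bounded ((\<lambda>z. 2 * sqrt_speed \<gamma> z * sqrt_speed' \<gamma> z) ` {l..B})"
      by (intro compact_imp_bounded compact_continuous_image) auto
    then obtain M where "\<forall>z\<in>{l..B}. \<bar>2 * sqrt_speed \<gamma> z * sqrt_speed' \<gamma> z\<bar> \<le> M"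
      by (auto simp: bounded_iff)
    then show ?thesis by (intro that[of M]) blast
  qed
  obtain M2 where M2: "\<And>t. t \<in> {0..\<tau>} \<Longrightarrow> \<bar>a t\<bar> \<le> M2"
  proof -
    have "continuous_on {0..\<tau>} a" by (rule continuous_on_subset[OF damping_cont]) auto
    then have "bounded (a ` {0..\<tau>})" by (intro compact_imp_bounded compact_continuous_image) auto
    then obtain M where "\<forall>t\<in>{0..\<tau>}. \<bar>a t\<bar> \<le> M"
      by (auto simp: bounded_iff)
    then show ?thesis by (intro that[of M]) blast
  qed
  have B0: "0 \<le> B" using slope_bound[OF \<tau>] by (meson abs_ge_zero order_trans)
  have bx_bound: "\<bar>bx t x\<bar> \<le> M1 * B" if "t \<in> {0..\<tau>}" for t x
  proof -
    have "u t x \<in> {l..B}" using l(2) u_upper that sub by auto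
    from M1[OF this] have "\<bar>2 * sqrt_speed \<gamma> (u t x) * sqrt_speed' \<gamma> (u t x)\<bar> * \<bar>ux t x\<bar> \<le> M1 * B"
      using slope_bound[of t x] that sub by (intro mult_mono) (auto intro: order_trans[OF abs_ge_zero])
    then show ?thesis using \<theta>' by (simp add: bx_def abs_mult)
  qed
  have wx_bound: "\<bar>riemann_inv_x \<theta> t x\<bar> \<le> B + wave_speed \<gamma> l * B" if t: "t \<in> {0..\<tau>}" for t x
  proof -
    have t': "t \<in> {0..<T}" using t sub by auto
    have "\<bar>wave_speed \<gamma> (u t x)\<bar> * \<bar>ux t x\<bar> \<le> wave_speed \<gamma> l * B"
      using slope_bound[OF t', of x] wave_speed_antimono[OF \<gamma> l(1) l(2)[OF t', of x]] wave_speed_pos[OF \<gamma> u_pos[OF t', of x]]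
      by (intro mult_mono) auto
    then have "\<bar>\<theta> * wave_speed \<gamma> (u t x) * ux t x\<bar> \<le> wave_speed \<gamma> l * B"
      using \<theta>' by (simp add: abs_mult)
    with slope_bound[OF t', of x] show ?thesis unfolding riemann_inv_x_def by linarith
  qed
  have Fx_bound: "\<bar>- a t * vx t x\<bar> \<le> M2 * B" if t: "t \<in> {0..\<tau>}" for t x
    unfolding abs_mult abs_minus using M2[OF t] slope_bound[of t x] t sub
    by (intro mult_mono) (auto intro: order_trans[OF abs_ge_zero])
  \<comment> \<open>\<open>M1 * B\<close> bounds the space derivative of the speed because
    \<open>u\<close> stays in the compact interval \<open>{l..B}\<close>; the added 1 makes the
    Lipschitz constant positive.\<close>
  obtain X where X: "X 0 = x0" "\<And>t. t \<in> {0..\<tau>} \<Longrightarrow> (X has_real_derivative - b t (X t)) (at t within {0..\<tau>})"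
  proof (rule picard_global[of \<tau> "M1 * B + 1" "\<lambda>t x. - b t x" x0])
    show "0 \<le> \<tau>" by fact
    show "0 < M1 * B + 1" using bx_bound[of 0 0] \<open>0 \<le> \<tau>\<close> by auto
    show "continuous_on ({0..\<tau>} \<times> UNIV) (\<lambda>p. - b (fst p) (snd p))"
      unfolding b_def J_def[symmetric] by (intro continuous_intros c_cont)
    fix t x y assume t: "t \<in> {0..\<tau>}"
    have "norm (b t x - b t y) \<le> (M1 * B) * norm (x - y)"
      by (rule field_differentiable_bound[of UNIV "b t" "bx t"]) (use b bx_bound t in auto)
    also have "\<dots> \<le> (M1 * B + 1) * norm (x - y)" by (intro mult_right_mono) auto
    finally show "\<bar>- b t x - - b t y\<bar> \<le> (M1 * B + 1) * \<bar>x - y\<bar>" by simp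
  qed blast
  have slope: "((\<lambda>t. riemann_inv_x \<theta> t (X t)) has_real_derivative bx t (X t) * riemann_inv_x \<theta> t (X t) + - a t * vx t (X t)) (at t within {0..\<tau>})"
    if t: "t \<in> {0..\<tau>}" for t
  proof (rule slope_along_characteristic[OF \<open>0 \<le> \<tau>\<close> _ b F wx_cont[unfolded J_def] bx_cont[unfolded J_def] Fx_cont[unfolded J_def] _ X(2) t])
    show "has_gradient_on {0..\<tau>} (riemann_inv \<theta>) (\<lambda>t x. b t x * riemann_inv_x \<theta> t x + - a t * v t x) (riemann_inv_x \<theta>)"
      using has_gradient_on_subset[OF riemann_inv_gradient[OF \<theta>] sub] by (simp add: b_def)
    show "\<bar>riemann_inv_x \<theta> s x\<bar> \<le> max (B + wave_speed \<gamma> l * B) (max (M1 * B) (M2 * B)) \<and>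
        \<bar>bx s x\<bar> \<le> max (B + wave_speed \<gamma> l * B) (max (M1 * B) (M2 * B)) \<and>
        \<bar>- a s * vx s x\<bar> \<le> max (B + wave_speed \<gamma> l * B) (max (M1 * B) (M2 * B))" if "s \<in> {0..\<tau>}" for s x
      using wx_bound[OF that, of x] bx_bound[OF that, of x] Fx_bound[OF that, of x] by (auto simp: le_max_iff_disj)
  qed
  show ?thesis
  proof (rule that[of X])
    show "X 0 = x0" by (rule X(1))
    fix t assume t: "t \<in> {0..\<tau>}"
    have pos: "0 < u t (X t)" using u_pos t sub by auto
    have "((\<lambda>t. u t (X t)) has_real_derivative vx t (X t) * 1 + ux t (X t) * - b t (X t)) (at t within {0..\<tau>})"
      using t by (intro has_gradient_on_along[OF u_grad] X) (use sub in auto)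
    then have U: "((\<lambda>t. u t (X t)) has_real_derivative vx t (X t) - ux t (X t) * b t (X t)) (at t within {0..\<tau>})"
      by simp
    have "((\<lambda>t. sqrt_speed \<gamma> (u t (X t)) * riemann_inv_x \<theta> t (X t) + a t / 2 * \<Phi> (u t (X t))) has_real_derivative
        (sqrt_speed' \<gamma> (u t (X t)) * (vx t (X t) - ux t (X t) * b t (X t))) * riemann_inv_x \<theta> t (X t)
        + (bx t (X t) * riemann_inv_x \<theta> t (X t) + - a t * vx t (X t)) * sqrt_speed \<gamma> (u t (X t))
        + (a' t / 2 * \<Phi> (u t (X t)) + (sqrt_speed \<gamma> (u t (X t)) * (vx t (X t) - ux t (X t) * b t (X t))) * (a t / 2)))
        (at t within {0..\<tau>})"
      by (intro DERIV_add DERIV_mult slope t DERIV_cdivide DERIV_subset[OF a[OF t]]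
          DERIV_chain2[OF sqrt_speed_deriv[OF pos] U] DERIV_chain2[OF \<Phi>[OF pos] U]) auto
    \<comment> \<open>Once c is written as the square of \<open>sqrt_speed\<close>, the products of
      the two slopes cancel, and the derivative of \<open>\<Phi>\<close> removes the other slope
      from the damping term.\<close>
    moreover have "(sqrt_speed' \<gamma> (u t (X t)) * (vx t (X t) - ux t (X t) * b t (X t))) * riemann_inv_x \<theta> t (X t)
        + (bx t (X t) * riemann_inv_x \<theta> t (X t) + - a t * vx t (X t)) * sqrt_speed \<gamma> (u t (X t))
        + (a' t / 2 * \<Phi> (u t (X t)) + (sqrt_speed \<gamma> (u t (X t)) * (vx t (X t) - ux t (X t) * b t (X t))) * (a t / 2))
      = sqrt_speed' \<gamma> (u t (X t)) * (riemann_inv_x \<theta> t (X t))\<^sup>2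
        - a t / 2 * (sqrt_speed \<gamma> (u t (X t)) * riemann_inv_x \<theta> t (X t)) + a' t / 2 * \<Phi> (u t (X t))"
      unfolding b_def bx_def riemann_inv_x_def wave_speed_eq_square[OF \<gamma> pos]
      by (simp add: field_simps power2_eq_square)
    ultimately show "((\<lambda>t. sqrt_speed \<gamma> (u t (X t)) * riemann_inv_x \<theta> t (X t) + a t / 2 * \<Phi> (u t (X t))) has_real_derivative
        sqrt_speed' \<gamma> (u t (X t)) * (riemann_inv_x \<theta> t (X t))\<^sup>2
        - a t / 2 * (sqrt_speed \<gamma> (u t (X t)) * riemann_inv_x \<theta> t (X t)) + a' t / 2 * \<Phi> (u t (X t)))
      (at t within {0..\<tau>})"
      by (rule DERIV_cong)
  qed
qed

lemma state_bounds:
  assumes t: "t \<in> {0..<T}"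
    and v0: "\<And>y. \<bar>v 0 y\<bar> \<le> m" and u0: "\<And>y. \<delta> \<le> u 0 y" "\<delta> > 0"
    and sep: "\<And>y. v 0 y - eta \<gamma> (u 0 y) \<le> - k" "\<And>y. k \<le> v 0 y + eta \<gamma> (u 0 y)"
  shows "k \<le> eta \<gamma> (u t x)" "eta \<gamma> (u t x) \<le> m + eta \<gamma> \<delta>" "\<bar>v t x\<bar> \<le> m + eta \<gamma> \<delta>"
proof -
  have "riemann_inv 1 t x \<le> - k \<and> - riemann_inv (- 1) t x \<le> - k"
  proof (rule riemann_inv_maximum_principle[OF _ t])
    fix y
    show "riemann_inv 1 0 y \<le> - k" "- riemann_inv (- 1) 0 y \<le> - k"
      using sep(1)[of y] sep(2)[of y] by (simp_all add: riemann_inv_def)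
  qed simp
  then show "k \<le> eta \<gamma> (u t x)" by (simp add: riemann_inv_def)
  have "eta \<gamma> (u 0 y) \<le> eta \<gamma> \<delta>" for y
    by (rule eta_antimono[OF \<gamma> u0(2) u0(1)])
  note init = this v0
  have "riemann_inv (- 1) t x \<le> m + eta \<gamma> \<delta> \<and> - riemann_inv (- (- 1)) t x \<le> m + eta \<gamma> \<delta>"
  proof (rule riemann_inv_maximum_principle[OF _ t])
    fix y
    show "riemann_inv (- 1) 0 y \<le> m + eta \<gamma> \<delta>" "- riemann_inv (- (- 1)) 0 y \<le> m + eta \<gamma> \<delta>"
      using init(1)[of y] init(2)[of y] by (auto simp: riemann_inv_def abs_le_iff)
  qed simp
  \<comment> \<open>With M = m + eta \<delta>, the facts s <= M and r >= - M give eta <= M by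
    subtraction; since eta > 0, also v = s - eta <= M and v = r + eta >= - M.\<close>
  then show "eta \<gamma> (u t x) \<le> m + eta \<gamma> \<delta>" "\<bar>v t x\<bar> \<le> m + eta \<gamma> \<delta>"
    using eta_pos[OF \<gamma> u_pos[OF t, of x]] by (auto simp: riemann_inv_def abs_le_iff)
qed

text \<open>Dividing by \<open>e0\<close>, a lower bound of the weight, turns the slope condition
  into one on the weighted slope, and the extra \<open>A * P\<close> pays for the correction with
  \<open>\<Phi>\<close>; so Z starts at or below \<open>- K\<close>. The Riccati rate \<kappa> / 8
  then gives the time 8 / (\<kappa> K).\<close>

lemma existence_time_bound:
  assumes "0 < T" and \<theta>: "\<theta> * \<theta> = 1"
    and a: "\<And>t. 0 \<le> t \<Longrightarrow> (a has_real_derivative a' t) (at t)"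
    and A: "\<And>t. 0 \<le> t \<Longrightarrow> a t \<le> A" "\<And>t. 0 \<le> t \<Longrightarrow> \<bar>a' t\<bar> \<le> A"
    and \<Phi>: "\<And>z. z > 0 \<Longrightarrow> (\<Phi> has_real_derivative sqrt_speed \<gamma> z) (at z)"
    and u: "\<And>t x. t \<in> {0..<T} \<Longrightarrow> u t x \<in> S"
    and P: "\<And>z. z \<in> S \<Longrightarrow> \<bar>\<Phi> z\<bar> \<le> P"
    and \<kappa>: "\<And>z. z \<in> S \<Longrightarrow> \<kappa> \<le> (\<gamma> + 1) / 4 * z powr ((\<gamma> + 1) / 4 - 1)" "0 < \<kappa>"
    and e0: "\<And>z. z \<in> S \<Longrightarrow> e0 \<le> sqrt_speed \<gamma> z" "0 < e0"
    and K: "K = 1 + 2 * A * P + 4 * (A + 1) / \<kappa>"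
    and x0: "riemann_inv_x \<theta> 0 x0 \<le> - ((K + A * P) / e0)"
  shows "T \<le> 8 / (\<kappa> * K)"
proof (rule ccontr)
  assume "\<not> T \<le> 8 / (\<kappa> * K)"
  then have T: "8 / (\<kappa> * K) < T" by simp
  have A0: "0 \<le> A" using damping_nonneg[of 0] A(1)[of 0] by linarith
    have t0: "0 \<in> {0..<T}" using \<open>0 < T\<close> by simp
    have P0: "0 \<le> P" using P[OF u[OF t0, of x0]] by linarith
    have AP: "0 \<le> A * P" using A0 P0 by simp
    have K1: "0 < K" using A0 P0 AP \<kappa>(2) unfolding K by (intro add_pos_pos add_pos_nonneg) auto
    \<comment> \<open>The system is only given on the half-open strip, so the contradiction is
      reached at a time strictly before \<open>T\<close>.\<close>
    obtain \<tau> where \<tau>: "8 / (\<kappa> * K) < \<tau>" "\<tau> < T" using dense[OF T] by blast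
    have "0 < 8 / (\<kappa> * K)" using \<kappa>(2) K1 by simp
    then have "0 \<le> \<tau>" using \<tau>(1) by linarith
    with \<tau> have \<tau>': "\<tau> \<in> {0..<T}" "0 \<le> \<tau>" by auto
    define Z' where "Z' = (\<lambda>X t. sqrt_speed' \<gamma> (u t (X t)) * (riemann_inv_x \<theta> t (X t))\<^sup>2
        - a t / 2 * (sqrt_speed \<gamma> (u t (X t)) * riemann_inv_x \<theta> t (X t)) + a' t / 2 * \<Phi> (u t (X t)))"
    define Z where "Z = (\<lambda>X t. sqrt_speed \<gamma> (u t (X t)) * riemann_inv_x \<theta> t (X t) + a t / 2 * \<Phi> (u t (X t)))"
    obtain X where X: "X 0 = x0"
      "\<And>t. t \<in> {0..\<tau>} \<Longrightarrow> (Z X has_real_derivative Z' X t) (at t within {0..\<tau>})"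
      unfolding Z_def Z'_def
      by (rule riccati_along_characteristic[OF \<theta> \<tau>'(1) _ \<Phi>, where a' = a' and ?x0.0 = x0]) (use a in auto)
    have small: "\<bar>a t / 2 * \<Phi> (u t y)\<bar> \<le> A * P" "\<bar>a' t / 2 * \<Phi> (u t y)\<bar> \<le> A * P" if t: "t \<in> {0..\<tau>}" for t y
    proof -
      have "\<bar>\<Phi> (u t y)\<bar> \<le> P" using t \<tau> by (intro P u) auto
      then show "\<bar>a t / 2 * \<Phi> (u t y)\<bar> \<le> A * P" "\<bar>a' t / 2 * \<Phi> (u t y)\<bar> \<le> A * P"
        unfolding abs_mult using A[of t] damping_nonneg[of t] t by (intro mult_mono; force)+
    qed
    have "\<tau> * (\<kappa> / 8 * K) \<le> 1"
    proof (rule riccati_time_bound[OF X(2)])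
      fix t assume t: "t \<in> {0..\<tau>}" and ZK: "Z X t \<le> - K"
      have tT: "t \<in> {0..<T}" "0 \<le> t" using t \<tau> by auto
      define y where "y = sqrt_speed \<gamma> (u t (X t)) * riemann_inv_x \<theta> t (X t)"
      define \<rho> where "\<rho> = (\<gamma> + 1) / 4 * (u t (X t)) powr ((\<gamma> + 1) / 4 - 1)"
      have "- \<rho> * y\<^sup>2 - a t / 2 * y + a' t / 2 * \<Phi> (u t (X t)) \<le> - (\<kappa> / 8) * (Z X t)\<^sup>2"
      proof (rule riccati_absorb[OF \<kappa>(2) A0 P0 K ZK])
        show "y \<le> Z X t + A * P" using small(1)[OF t, of "X t"] by (simp add: Z_def y_def abs_le_iff)
        show "a' t / 2 * \<Phi> (u t (X t)) \<le> A * P" using small(2)[OF t, of "X t"] by linarith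
        show "\<kappa> \<le> \<rho>" unfolding \<rho>_def by (intro \<kappa> u tT)
      qed (use A damping_nonneg tT in auto)
      also have "- \<rho> * y\<^sup>2 - a t / 2 * y + a' t / 2 * \<Phi> (u t (X t)) = Z' X t"
        unfolding Z'_def y_def \<rho>_def sqrt_speed'_eq[OF u_pos[OF tT(1)]] by (simp add: power_mult_distrib)
      finally show "Z' X t \<le> - (\<kappa> / 8) * (Z X t)\<^sup>2" .
    next
      have "sqrt_speed \<gamma> (u 0 x0) * riemann_inv_x \<theta> 0 x0 \<le> sqrt_speed \<gamma> (u 0 x0) * - ((K + A * P) / e0)"
        using x0 by (rule mult_left_mono) (rule less_imp_le[OF sqrt_speed_pos[OF u_pos[OF t0]]])
      also have "\<dots> \<le> e0 * - ((K + A * P) / e0)"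
        using e0 u[OF t0, of x0] K1 AP by (intro mult_right_mono_neg) auto
      also have "\<dots> = - K - A * P" using e0(2) by simp
      finally show "Z X 0 \<le> - K" using small(1)[of 0 x0] \<tau>'(2) by (simp add: Z_def X(1) abs_le_iff)
    qed (use \<kappa> K1 \<tau>' in auto)
    then have "\<tau> * (\<kappa> * K) \<le> 8" by (simp add: mult_ac)
    then have "\<tau> \<le> 8 / (\<kappa> * K)" using \<kappa>(2) K1 by (simp add: pos_le_divide_eq)
    with \<tau>(1) show False by simp
qed

end

text \<open>The point is the order of quantifiers: \<open>K\<close> and \<open>T0\<close> are fixed
  by the range of \<open>u\<close> and by \<open>A\<close> before the solution, its strip and its
  constants \<open>l\<close> and \<open>B\<close> are chosen.\<close>

lemma blowup_threshold:
  assumes "\<gamma> > 1" "0 < ul" "ul \<le> uh" "0 \<le> A"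
  obtains K T0 where "K > 0"
    "\<And>T l B a a' u v ux vx \<theta> x0.
       \<lbrakk>damped_p_system \<gamma> T l B a u v ux vx; T > 0; \<theta> * \<theta> = 1;
        \<And>t. 0 \<le> t \<Longrightarrow> (a has_real_derivative a' t) (at t);
        \<And>t. 0 \<le> t \<Longrightarrow> a t \<le> A; \<And>t. 0 \<le> t \<Longrightarrow> \<bar>a' t\<bar> \<le> A;
        \<And>t x. t \<in> {0..<T} \<Longrightarrow> u t x \<in> {ul..uh};
        vx 0 x0 + \<theta> * wave_speed \<gamma> (u 0 x0) * ux 0 x0 \<le> - K\<rbrakk> \<Longrightarrow> T \<le> T0"
proof -
  obtain \<Phi> where \<Phi>: "\<And>z. z > 0 \<Longrightarrow> (\<Phi> has_real_derivative sqrt_speed \<gamma> z) (at z)"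
    using sqrt_speed_antiderivative[of \<gamma>] by blast
  have pos: "z > 0" if "z \<in> {ul..uh}" for z using that assms(2) by auto
  have "continuous_on {ul..uh} \<Phi>"
    by (rule DERIV_continuous_on) (auto intro!: DERIV_subset[OF \<Phi>] pos)
  then have "bounded (\<Phi> ` {ul..uh})" by (intro compact_imp_bounded compact_continuous_image) auto
  then obtain P where "\<forall>z\<in>{ul..uh}. \<bar>\<Phi> z\<bar> \<le> P" unfolding bounded_iff by auto
  then have P: "\<And>z. z \<in> {ul..uh} \<Longrightarrow> \<bar>\<Phi> z\<bar> \<le> P" by blast
  have min: "\<exists>k>0. \<forall>z\<in>{ul..uh}. k \<le> h z"
    if cont: "continuous_on {ul..uh} h" and h: "\<And>z. z > 0 \<Longrightarrow> h z > 0" for h :: "real \<Rightarrow> real"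
  proof -
    obtain z0 where "z0 \<in> {ul..uh}" "\<forall>z\<in>{ul..uh}. h z0 \<le> h z"
      using continuous_attains_inf[OF _ _ cont] assms(3) by auto
    then show ?thesis using h[OF pos] by blast
  qed
  obtain e0 where e0: "e0 > 0" "\<And>z. z \<in> {ul..uh} \<Longrightarrow> e0 \<le> sqrt_speed \<gamma> z"
    using min[OF continuous_on_subset[OF continuous_on_sqrt_speed] sqrt_speed_pos] pos by (metis greaterThan_iff subsetI)
  have "continuous_on {ul..uh} (\<lambda>z. (\<gamma> + 1) / 4 * z powr ((\<gamma> + 1) / 4 - 1))"
    by (intro continuous_intros) (use assms(2) in auto)
  from min[OF this] obtain \<kappa> where \<kappa>: "\<kappa> > 0"
      "\<And>z. z \<in> {ul..uh} \<Longrightarrow> \<kappa> \<le> (\<gamma> + 1) / 4 * z powr ((\<gamma> + 1) / 4 - 1)"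
    using \<open>\<gamma> > 1\<close> by auto
  define K1 where "K1 = 1 + 2 * A * P + 4 * (A + 1) / \<kappa>"
  have "0 \<le> P" using P[of ul] assms(3) by force
  then have "0 \<le> A * P" "0 \<le> 4 * (A + 1) / \<kappa>" using \<kappa>(1) assms(4) by simp_all
  then have "0 < (K1 + A * P) / e0" using e0(1) by (simp add: K1_def)
  moreover have "T \<le> 8 / (\<kappa> * K1)"
    if "damped_p_system \<gamma> T l B a u v ux vx" "T > 0" "\<theta> * \<theta> = 1"
      "\<And>t. 0 \<le> t \<Longrightarrow> (a has_real_derivative a' t) (at t)"
      "\<And>t. 0 \<le> t \<Longrightarrow> a t \<le> A" "\<And>t. 0 \<le> t \<Longrightarrow> \<bar>a' t\<bar> \<le> A"
      "\<And>t x. t \<in> {0..<T} \<Longrightarrow> u t x \<in> {ul..uh}"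
      "vx 0 x0 + \<theta> * wave_speed \<gamma> (u 0 x0) * ux 0 x0 \<le> - ((K1 + A * P) / e0)"
    for T l B a a' u v ux vx \<theta> x0
  proof -
    interpret damped_p_system \<gamma> T l B a u v ux vx by fact
    show ?thesis
      by (rule existence_time_bound[OF that(2,3,4,5,6) \<Phi> that(7) P \<kappa>(2,1) e0(2,1) K1_def])
        (use that(8) in \<open>simp_all add: riemann_inv_x_def\<close>)
  qed
  ultimately show ?thesis by (rule that)
qed

subsection \<open>From the Cauchy problem to the p-system on a strip\<close>

lemma Linf_norm_nonneg: "0 \<le> Linf_norm f"
proof -
  have "esssup lborel (\<lambda>x :: real. 0 :: ereal) \<le> esssup lborel (\<lambda>x. ereal (norm (f x)))"
    by (rule esssup_mono) auto
  moreover have "esssup lborel (\<lambda>x :: real. 0 :: ereal) = 0"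
    by (rule esssup_const) simp
  ultimately show ?thesis by (simp add: Linf_norm_def)
qed

text \<open>The set where a continuous function exceeds its essential bound is open and null, hence
  empty.\<close>

lemma norm_le_Linf_norm:
  assumes "continuous_on UNIV f" "Linf_norm f \<le> ereal B"
  shows "norm (f x) \<le> B"
proof (rule ccontr)
  assume neg: "\<not> norm (f x) \<le> B"
  define S where "S = {y. B < norm (f y)}"
  have "open S" unfolding S_def using assms(1) by (intro open_Collect_less continuous_intros)
  have "AE y in lborel. ereal (norm (f y)) \<le> Linf_norm f"
    unfolding Linf_norm_def by (rule esssup_AE)
  then have "AE y in lborel. y \<notin> S"
  proof eventually_elim
    fix y assume "ereal (norm (f y)) \<le> Linf_norm f"
    then have "ereal (norm (f y)) \<le> ereal B" using assms(2) by (rule order_trans)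
    then show "y \<notin> S" by (simp add: S_def)
  qed
  then have "S \<in> null_sets lborel"
    using \<open>open S\<close> by (subst (asm) AE_iff_null_sets[symmetric]) auto
  then have "negligible S"
    by (simp add: negligible_iff_null_sets null_sets_completionI)
  moreover have "x \<in> S" using neg by (simp add: S_def)
  ultimately show False using open_not_negligible[OF \<open>open S\<close>] by blast
qed

lemma Linf_norm_leI:
  assumes "continuous_on UNIV f" "\<And>x. norm (f x) \<le> B"
  shows "Linf_norm f \<le> ereal B"
  unfolding Linf_norm_def
proof (rule esssup_I)
  have "continuous_on UNIV (\<lambda>x. ereal (norm (f x)))"
    using assms(1) by (intro continuous_intros)
  then show "(\<lambda>x. ereal (norm (f x))) \<in> borel_measurable lborel"
    by (simp add: borel_measurable_continuous_onI)
qed (use assms(2) in auto)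

lemma X_set_bounds:
  assumes "(u0, v0) \<in> X_set m \<delta>"
  shows "\<bar>u0 x\<bar> \<le> m" "\<bar>v0 x\<bar> \<le> m" "\<delta> \<le> u0 x"
proof -
  have C1: "u0 \<in> C1b" "v0 \<in> C1b" and sum: "Linf_norm u0 + Linf_norm v0 \<le> ereal m" and "\<delta> \<le> u0 x"
    using assms by (auto simp: X_set_def)
  then show "\<delta> \<le> u0 x" by simp
  have "Linf_norm u0 \<le> Linf_norm u0 + Linf_norm v0" "Linf_norm v0 \<le> Linf_norm u0 + Linf_norm v0"
    using Linf_norm_nonneg[of u0] Linf_norm_nonneg[of v0] by (simp_all add: ereal_le_add_self ereal_le_add_self2)
  with sum have "Linf_norm u0 \<le> ereal m" "Linf_norm v0 \<le> ereal m" by (auto intro: order_trans)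
  moreover have "continuous_on UNIV u0" "continuous_on UNIV v0"
    using C1 by (auto simp: C1b_def intro: C1_differentiable_imp_continuous_on)
  ultimately show "\<bar>u0 x\<bar> \<le> m" "\<bar>v0 x\<bar> \<le> m"
    using norm_le_Linf_norm[of u0 m x] norm_le_Linf_norm[of v0 m x] by auto
qed

lemma C1_on_strip_slice:
  assumes "C1_on_strip T w" "t \<in> {0..<T}"
  shows "continuous_on UNIV (w t)" "continuous_on UNIV (pdt w t)" "continuous_on UNIV (pdx w t)"
proof -
  have "continuous_on UNIV (\<lambda>x. (t, x))" by (intro continuous_intros)
  moreover have "range (\<lambda>x. (t, x)) \<subseteq> {0..<T} \<times> UNIV" using assms(2) by blast
  moreover have "continuous_on ({0..<T} \<times> UNIV) (\<lambda>(t, x). pdt w t x)"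
    "continuous_on ({0..<T} \<times> UNIV) (\<lambda>(t, x). pdx w t x)"
    using assms(1) by (auto simp: C1_on_strip_def)
  ultimately show "continuous_on UNIV (pdt w t)" "continuous_on UNIV (pdx w t)"
    using continuous_on_compose2[of "{0..<T} \<times> UNIV" "\<lambda>(t, x). pdt w t x" UNIV "\<lambda>x. (t, x)"]
      continuous_on_compose2[of "{0..<T} \<times> UNIV" "\<lambda>(t, x). pdx w t x" UNIV "\<lambda>x. (t, x)"] by simp_all
  show "continuous_on UNIV (w t)"
    by (rule DERIV_continuous_on)
      (rule has_gradient_on_snd[OF C1_strip_has_gradient[OF assms(1)] assms(2)])
qed

text \<open>All summands are nonnegative, so a bound on their sum bounds each, and continuity of the
  slices makes it pointwise. The last conclusion is the bound on |p'(u)|; it is what keeps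
  \<open>u\<close> away from 0 on the strip.\<close>

lemma bounded_on_strip_pointwise:
  assumes "\<gamma> > 1"
    and u: "C1_on_strip T u" and v: "C1_on_strip T v"
    and pos: "\<And>t x. t \<in> {0..<T} \<Longrightarrow> 0 < u t x"
    and bdd: "bounded_on_strip \<gamma> T u v"
  obtains B where "\<And>t x. t \<in> {0..<T} \<Longrightarrow> \<bar>u t x\<bar> \<le> B" "\<And>t x. t \<in> {0..<T} \<Longrightarrow> \<bar>v t x\<bar> \<le> B"
    "\<And>t x. t \<in> {0..<T} \<Longrightarrow> \<bar>pdx u t x\<bar> \<le> B" "\<And>t x. t \<in> {0..<T} \<Longrightarrow> \<bar>pdx v t x\<bar> \<le> B"
    "\<And>t x. t \<in> {0..<T} \<Longrightarrow> u t x powr (- \<gamma> - 1) \<le> B"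
proof -
  define N1 where "N1 = (\<lambda>t. Linf_norm (\<lambda>x. (u t x, v t x)))"
  define N2 where "N2 = (\<lambda>t. Linf_norm (\<lambda>x. (pdt u t x, pdt v t x)))"
  define N3 where "N3 = (\<lambda>t. Linf_norm (\<lambda>x. (pdx u t x, pdx v t x)))"
  define N4 where "N4 = (\<lambda>t. Linf_norm (\<lambda>x. deriv (pressure \<gamma>) (u t x)))"
  have N: "0 \<le> N1 t" "0 \<le> N2 t" "0 \<le> N3 t" "0 \<le> N4 t" for t
    by (simp_all add: N1_def N2_def N3_def N4_def Linf_norm_nonneg)
  have "(SUP t\<in>{0..<T}. N1 t + N2 t + N3 t + N4 t) < \<infinity>"
    using bdd by (simp add: bounded_on_strip_def N1_def N2_def N3_def N4_def)
  from ereal_dense2[OF this] obtain B where B: "(SUP t\<in>{0..<T}. N1 t + N2 t + N3 t + N4 t) < ereal B"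
    by blast
  have le: "N1 t \<le> ereal B" "N3 t \<le> ereal B" "N4 t \<le> ereal B" if "t \<in> {0..<T}" for t
  proof -
    have S: "N1 t + N2 t + N3 t + N4 t \<le> ereal B"
      using SUP_upper[OF that, of "\<lambda>t. N1 t + N2 t + N3 t + N4 t"] B by (meson less_imp_le order_trans)
    have 1: "N1 t \<le> N1 t + N2 t + N3 t + N4 t"
      by (intro add_increasing2 N order_refl)
    have 3: "N3 t \<le> N1 t + N2 t + N3 t + N4 t"
      by (rule add_increasing2[OF N(4) add_increasing[OF add_nonneg_nonneg[OF N(1,2)] order_refl]])
    have 4: "N4 t \<le> N1 t + N2 t + N3 t + N4 t"
      by (rule add_increasing[OF add_nonneg_nonneg[OF add_nonneg_nonneg[OF N(1,2)] N(3)] order_refl])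
    show "N1 t \<le> ereal B" "N3 t \<le> ereal B" "N4 t \<le> ereal B"
      by (rule order_trans[OF 1 S] order_trans[OF 3 S] order_trans[OF 4 S])+
  qed
  show ?thesis
  proof (rule that)
    fix t x assume t: "t \<in> {0..<T}"
    note cont = C1_on_strip_slice[OF u t] C1_on_strip_slice[OF v t]
    have "norm (u t x, v t x) \<le> B"
      by (rule norm_le_Linf_norm) (use le(1)[OF t] in \<open>auto simp: N1_def intro!: continuous_on_Pair cont\<close>)
    then show "\<bar>u t x\<bar> \<le> B" "\<bar>v t x\<bar> \<le> B"
      using norm_fst_le[of "u t x" "v t x"] norm_snd_le[of "v t x" "u t x"] by simp_all
    have "norm (pdx u t x, pdx v t x) \<le> B"
      by (rule norm_le_Linf_norm) (use le(2)[OF t] in \<open>auto simp: N3_def intro!: continuous_on_Pair cont\<close>)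
    then show "\<bar>pdx u t x\<bar> \<le> B" "\<bar>pdx v t x\<bar> \<le> B"
      using norm_fst_le[of "pdx u t x" "pdx v t x"] norm_snd_le[of "pdx v t x" "pdx u t x"] by simp_all
    have D: "deriv (pressure \<gamma>) (u t y) = - (u t y powr (- \<gamma> - 1))" for y
      using pressure_has_real_derivative[OF \<open>\<gamma> > 1\<close> pos[OF t]] by (rule DERIV_imp_deriv)
    have "continuous_on UNIV (\<lambda>y. - (u t y powr (- \<gamma> - 1)))"
      using pos[OF t] by (intro continuous_intros cont) (auto simp: less_imp_neq[THEN not_sym])
    from norm_le_Linf_norm[OF this, of B x] show "u t x powr (- \<gamma> - 1) \<le> B"
      using le(3)[OF t] by (simp add: N4_def D)
  qed
qed

lemma C1_solution_damped_p_system: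
  assumes "\<gamma> > 1" "0 \<le> lam"
    and sol: "C1_solution \<gamma> \<mu> lam u0 v0 T u v" and bdd: "bounded_on_strip \<gamma> T u v"
  obtains l B where "damped_p_system \<gamma> T l B (\<lambda>t. lam / (1 + t) powr \<mu>) u v (pdx u) (pdx v)"
proof -
  have u: "C1_on_strip T u" and v: "C1_on_strip T v"
    and pos: "\<And>t x. t \<in> {0..<T} \<Longrightarrow> 0 < u t x"
    and ut: "\<And>t x. t \<in> {0..<T} \<Longrightarrow> pdt u t x = pdx v t x"
    and vt: "\<And>t x. t \<in> {0..<T} \<Longrightarrow>
        pdt v t x + pdx (\<lambda>\<tau> y. pressure \<gamma> (u \<tau> y)) t x = - (lam / (1 + t) powr \<mu>) * v t x"
    using sol by (auto simp: C1_solution_def)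
  obtain B where B: "\<And>t x. t \<in> {0..<T} \<Longrightarrow> \<bar>u t x\<bar> \<le> B"
    "\<And>t x. t \<in> {0..<T} \<Longrightarrow> \<bar>pdx u t x\<bar> \<le> B" "\<And>t x. t \<in> {0..<T} \<Longrightarrow> \<bar>pdx v t x\<bar> \<le> B"
    "\<And>t x. t \<in> {0..<T} \<Longrightarrow> u t x powr (- \<gamma> - 1) \<le> B"
    using bounded_on_strip_pointwise[OF \<open>\<gamma> > 1\<close> u v pos bdd] by metis
  \<comment> \<open>\<open>l\<close> is the point at which z^(- \<gamma> - 1) equals
    \<open>b\<close>; the maximum with 1 keeps \<open>b\<close> positive.\<close>
  define b where "b = max B 1"
  define l where "l = b powr (- 1 / (\<gamma> + 1))"
  have l: "l > 0" by (simp add: l_def b_def)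
  have lu: "l \<le> u t x" if t: "t \<in> {0..<T}" for t x
  proof (rule ccontr)
    assume "\<not> l \<le> u t x"
    then have "l powr (- \<gamma> - 1) < u t x powr (- \<gamma> - 1)"
      using pos[OF t, of x] \<open>\<gamma> > 1\<close> by (intro powr_less_mono2_neg) auto
    moreover have "l powr (- \<gamma> - 1) = b"
    proof -
      have "- 1 / (\<gamma> + 1) * (- \<gamma> - 1) = 1" using \<open>\<gamma> > 1\<close> by (simp add: field_simps)
      then show ?thesis unfolding l_def powr_powr by (simp add: b_def)
    qed
    ultimately show False using B(4)[OF t, of x] by (simp add: b_def)
  qed
  have vt': "pdt v t x = (wave_speed \<gamma> (u t x))\<^sup>2 * pdx u t x - lam / (1 + t) powr \<mu> * v t x"
    if t: "t \<in> {0..<T}" for t x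
  proof -
    have "((\<lambda>y. pressure \<gamma> (u t y)) has_real_derivative - (u t x powr (- \<gamma> - 1)) * pdx u t x) (at x)"
      by (rule DERIV_chain2[OF pressure_has_real_derivative[OF \<open>\<gamma> > 1\<close> pos[OF t]]
            has_gradient_on_snd[OF C1_strip_has_gradient[OF u] t]])
    then have "pdx (\<lambda>\<tau> y. pressure \<gamma> (u \<tau> y)) t x = - (u t x powr (- \<gamma> - 1)) * pdx u t x"
      unfolding pdx_def by (rule DERIV_imp_deriv)
    with vt[OF t, of x] wave_speed_square[OF \<open>\<gamma> > 1\<close> pos[OF t, of x]] show ?thesis by simp
  qed
  have "damped_p_system \<gamma> T l B (\<lambda>t. lam / (1 + t) powr \<mu>) u v (pdx u) (pdx v)"
  proof
    show "0 \<le> lam / (1 + t) powr \<mu>" for t using assms(2) by simp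
    show "continuous_on {0..} (\<lambda>t. lam / (1 + t) powr \<mu>)"
      by (intro continuous_intros) auto
    show "has_gradient_on {0..<T} u (pdx v) (pdx u)"
      by (rule has_gradient_on_cong[OF C1_strip_has_gradient[OF u] ut])
    show "has_gradient_on {0..<T} v (\<lambda>t x. (wave_speed \<gamma> (u t x))\<^sup>2 * pdx u t x - lam / (1 + t) powr \<mu> * v t x) (pdx v)"
      by (rule has_gradient_on_cong[OF C1_strip_has_gradient[OF v] vt'])
    show "continuous_on ({0..<T} \<times> UNIV) (\<lambda>p. pdx u (fst p) (snd p))"
      "continuous_on ({0..<T} \<times> UNIV) (\<lambda>p. pdx v (fst p) (snd p))"
      using u v by (auto simp: C1_on_strip_def case_prod_unfold)
    show "u t x \<le> B" if "t \<in> {0..<T}" for t x using B(1)[OF that, of x] by linarith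
  qed (use \<open>\<gamma> > 1\<close> l lu B in auto)
  then show ?thesis by (rule that)
qed

section \<open>The damping coefficient and its time derivative\<close>

lemma damping_deriv:
  assumes "0 \<le> t"
  shows "((\<lambda>t. lam / (1 + t) powr \<mu>) has_real_derivative - lam * \<mu> * (1 + t) powr (- \<mu> - 1)) (at t)"
proof -
  have "((\<lambda>t. lam * (1 + t) powr (- \<mu>)) has_real_derivative lam * (- \<mu> * (1 + t) powr (- \<mu> - 1) * 1)) (at t)"
    using assms by (intro DERIV_cmult DERIV_chain2[OF has_real_derivative_powr]) (auto intro!: derivative_eq_intros)
  then show ?thesis by (simp add: powr_minus_divide mult.assoc)
qed

text \<open>A single constant serves for both, since \<open>lam \<le> lam * \<mu>\<close> when
  \<open>1 \<le> \<mu>\<close>; it becomes \<open>A\<close> in the blow-up estimate.\<close>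

lemma damping_bounds:
  fixes lam \<mu> t :: real
  assumes "0 \<le> lam" "1 \<le> \<mu>" "0 \<le> t"
  shows "lam / (1 + t) powr \<mu> \<le> lam * \<mu>" "\<bar>- lam * \<mu> * (1 + t) powr (- \<mu> - 1)\<bar> \<le> lam * \<mu>"
proof -
  have 1: "(1 + t) powr (- \<mu>) \<le> 1" "(1 + t) powr (- \<mu> - 1) \<le> 1"
    using assms powr_mono[of "- \<mu>" 0 "1 + t"] powr_mono[of "- \<mu> - 1" 0 "1 + t"] by auto
  have "lam * (1 + t) powr (- \<mu>) \<le> lam * \<mu>"
    using 1 assms by (intro mult_left_mono) auto
  then show "lam / (1 + t) powr \<mu> \<le> lam * \<mu>" by (simp add: powr_minus_divide)
  have "lam * \<mu> * (1 + t) powr (- \<mu> - 1) \<le> lam * \<mu> * 1"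
    using 1 assms by (intro mult_left_mono) auto
  then show "\<bar>- lam * \<mu> * (1 + t) powr (- \<mu> - 1)\<bar> \<le> lam * \<mu>"
    using assms by (simp add: abs_mult)
qed

subsection \<open>Invariant region and blow-up\<close>

text \<open>Letting one of the two points tend to \<open>-\<infinity>\<close> turns the smallness of \<open>s(x) + r(y)\<close> into a strict
  separation of the two Riemann invariants by \<open>0\<close>.\<close>

lemma riemann_separation:
  fixes u0 v0 :: "real \<Rightarrow> real"
  assumes "\<gamma> > 1" "um > 0"
    and lim: "((\<lambda>x. (u0 x, v0 x)) \<longlongrightarrow> (um, vm)) at_bot"
    and SUP: "(SUP (x, y)\<in>UNIV. ereal \<bar>riemann_s \<gamma> (u0 x) (v0 x) + riemann_r \<gamma> (u0 y) (v0 y)\<bar>)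
          < ereal (1 / (\<gamma> - 1) * um powr (- ((\<gamma> - 1) / 2)))"
  shows "v0 y - eta \<gamma> (u0 y) \<le> - (eta \<gamma> um / 4)" "eta \<gamma> um / 4 \<le> v0 y + eta \<gamma> (u0 y)"
proof -
  define h where "h = eta \<gamma> um / 2"
  define r where "r = (\<lambda>x. v0 x - eta \<gamma> (u0 x))"
  define s where "s = (\<lambda>x. v0 x + eta \<gamma> (u0 x))"
  have h: "1 / (\<gamma> - 1) * um powr (- ((\<gamma> - 1) / 2)) = h"
    unfolding h_def eta_eq[OF assms(1,2)] using assms(1) by (simp add: field_simps)
  have sr: "\<bar>s x + r y\<bar> \<le> h" for x y
  proof -
    have "ereal \<bar>s x + r y\<bar> \<le> (SUP (x, y)\<in>UNIV. ereal \<bar>riemann_s \<gamma> (u0 x) (v0 x) + riemann_r \<gamma> (u0 y) (v0 y)\<bar>)"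
      by (rule SUP_upper2[of "(x, y)"]) (auto simp: r_def s_def riemann_r_def riemann_s_def)
    also note SUP
    finally show ?thesis unfolding h by simp
  qed
  have u_lim: "(u0 \<longlongrightarrow> um) at_bot" and v_lim: "(v0 \<longlongrightarrow> vm) at_bot"
    using tendsto_fst[OF lim] tendsto_snd[OF lim] by simp_all
  have "isCont (eta \<gamma>) um" using eta_deriv[OF assms(1,2)] by (rule DERIV_isCont)
  from isCont_tendsto_compose[OF this u_lim]
  have r_lim: "(r \<longlongrightarrow> vm - eta \<gamma> um) at_bot" and s_lim: "(s \<longlongrightarrow> vm + eta \<gamma> um) at_bot"
    unfolding r_def s_def by (intro tendsto_intros v_lim; simp)+
  have sx: "\<bar>s x + (vm - eta \<gamma> um)\<bar> \<le> h" for x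
    by (rule tendsto_upperbound[OF tendsto_rabs[OF tendsto_add[OF tendsto_const r_lim]]]) (auto simp: sr)
  have ry: "\<bar>(vm + eta \<gamma> um) + r y\<bar> \<le> h" for y
    by (rule tendsto_upperbound[OF tendsto_rabs[OF tendsto_add[OF s_lim tendsto_const]]]) (auto simp: sr)
  \<comment> \<open>Sending both points to minus infinity gives |2 vm| <= h, that is |vm| <= eta(um)
    / 4. In \<open>sx\<close> and \<open>ry\<close> this leaves eta - eta / 2 - eta / 4, hence the
    factor 1/4.\<close>
  have "\<bar>(vm + eta \<gamma> um) + (vm - eta \<gamma> um)\<bar> \<le> h"
    by (rule tendsto_upperbound[OF tendsto_rabs[OF tendsto_add[OF s_lim tendsto_const]]]) (auto simp: sx)
  with sx[of y] ry[of y] show "v0 y - eta \<gamma> (u0 y) \<le> - (eta \<gamma> um / 4)" "eta \<gamma> um / 4 \<le> v0 y + eta \<gamma> (u0 y)"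
    unfolding h_def r_def s_def by linarith+
qed

lemma solution_state_bounds:
  assumes "\<gamma> > 1" "0 \<le> lam" "0 < \<delta>" "um > 0"
    and X: "(u0, v0) \<in> X_set m \<delta>"
    and lim: "((\<lambda>x. (u0 x, v0 x)) \<longlongrightarrow> (um, vm)) at_bot"
    and SUP: "(SUP (x, y)\<in>UNIV. ereal \<bar>riemann_s \<gamma> (u0 x) (v0 x) + riemann_r \<gamma> (u0 y) (v0 y)\<bar>)
          < ereal (1 / (\<gamma> - 1) * um powr (- ((\<gamma> - 1) / 2)))"
    and sol: "C1_solution \<gamma> \<mu> lam u0 v0 T u v" and bdd: "bounded_on_strip \<gamma> T u v"
    and ul: "0 < ul" "eta \<gamma> ul = m + eta \<gamma> \<delta>" and uh: "0 < uh" "eta \<gamma> uh = eta \<gamma> m / 4"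
    and t: "t \<in> {0..<T}"
  shows "u t x \<in> {ul..uh}" "\<bar>v t x\<bar> \<le> m + eta \<gamma> \<delta>"
proof -
  obtain l B where "damped_p_system \<gamma> T l B (\<lambda>t. lam / (1 + t) powr \<mu>) u v (pdx u) (pdx v)"
    by (rule C1_solution_damped_p_system[OF assms(1,2) sol bdd])
  then interpret damped_p_system \<gamma> T l B "\<lambda>t. lam / (1 + t) powr \<mu>" u v "pdx u" "pdx v" .
  have init: "u 0 y = u0 y" "v 0 y = v0 y" for y using sol by (auto simp: C1_solution_def)
  have "(u0 \<longlongrightarrow> um) at_bot" using tendsto_fst[OF lim] by simp
  then have "um \<le> m"
    by (rule tendsto_upperbound) (use X_set_bounds(1)[OF X] in \<open>auto simp: abs_le_iff\<close>)
  note b = state_bounds[OF t, where m = m and \<delta> = \<delta> and k = "eta \<gamma> um / 4" and x = x, unfolded init,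
      OF X_set_bounds(2,3)[OF X] \<open>0 < \<delta>\<close> riemann_separation[OF assms(1,4) lim SUP]]
  have "eta \<gamma> m \<le> eta \<gamma> um" using eta_antimono[OF \<gamma> \<open>um > 0\<close> \<open>um \<le> m\<close>] .
  with b uh ul have "eta \<gamma> uh \<le> eta \<gamma> (u t x)" "eta \<gamma> (u t x) \<le> eta \<gamma> ul" by auto
  with eta_strict_antimono[OF \<gamma> u_pos[OF t, of x], of ul] eta_strict_antimono[OF \<gamma> uh(1), of "u t x"]
  show "u t x \<in> {ul..uh}" by (auto simp: not_less[symmetric])
  show "\<bar>v t x\<bar> \<le> m + eta \<gamma> \<delta>" by (rule b(3))
qed

text \<open>The slope bound \<open>B\<close> of the strip is used only for membership in
  \<open>C1b\<close>. It may grow with \<open>T\<close>, but \<open>X_set\<close> asks only for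
  finiteness there.\<close>

lemma solution_in_X_set:
  assumes "\<gamma> > 1" and sol: "C1_solution \<gamma> \<mu> lam u0 v0 T u v" and bdd: "bounded_on_strip \<gamma> T u v"
    and t: "t \<in> {0..<T}"
    and u: "\<And>x. u t x \<in> {ul..uh}" and v: "\<And>x. \<bar>v t x\<bar> \<le> M" and "0 < ul"
  shows "(u t, v t) \<in> X_set (uh + M) ul"
proof -
  have su: "C1_on_strip T u" and sv: "C1_on_strip T v"
    and pos: "\<And>t x. t \<in> {0..<T} \<Longrightarrow> 0 < u t x"
    using sol by (auto simp: C1_solution_def)
  obtain B where B: "\<And>t x. t \<in> {0..<T} \<Longrightarrow> \<bar>pdx u t x\<bar> \<le> B" "\<And>t x. t \<in> {0..<T} \<Longrightarrow> \<bar>pdx v t x\<bar> \<le> B"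
    using bounded_on_strip_pointwise[OF \<open>\<gamma> > 1\<close> su sv pos bdd] by metis
  have C1b: "w t \<in> C1b" if w: "C1_on_strip T w" and "\<And>x. \<bar>w t x\<bar> \<le> k" and "\<And>x. \<bar>pdx w t x\<bar> \<le> B" for w k
  proof -
    have "(w t has_vector_derivative pdx w t x) (at x)" for x
      using has_gradient_on_snd[OF C1_strip_has_gradient[OF w] t]
      by (simp add: has_real_derivative_iff_has_vector_derivative)
    then have "w t C1_differentiable_on UNIV"
      using C1_on_strip_slice(3)[OF w t] unfolding C1_differentiable_on_def by blast
    moreover have "deriv (w t) = pdx w t" by (simp add: pdx_def fun_eq_iff)
    ultimately show ?thesis
      using that by (auto simp: C1b_def bounded_iff)
  qed
  have u_abs: "\<bar>u t x\<bar> \<le> uh" for x using u[of x] \<open>0 < ul\<close> by auto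
  have "Linf_norm (u t) \<le> ereal uh" "Linf_norm (v t) \<le> ereal M"
    by (auto intro!: Linf_norm_leI C1_on_strip_slice[OF su t] C1_on_strip_slice[OF sv t] simp: u_abs v)
  then have "Linf_norm (u t) + Linf_norm (v t) \<le> ereal (uh + M)"
    unfolding plus_ereal.simps(1)[symmetric] by (rule add_mono)
  with C1b[OF su u_abs B(1)[OF t]] C1b[OF sv v B(2)[OF t]] u show ?thesis
    by (auto simp: X_set_def)
qed

theorem theorem2p1:
  fixes \<gamma> m \<delta> \<mu> lam :: real
  assumes "\<gamma> > 1" and "m > 0" and "\<delta> > 0"
    and "(\<mu> = 1 \<and> 0 \<le> lam \<and> lam \<le> 2) \<or> (\<mu> > 1 \<and> lam \<ge> 0)"
  shows
    "(\<forall>u0 v0 um vm u v.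
        (u0, v0) \<in> X_set m \<delta> \<longrightarrow> um > 0 \<longrightarrow>
        ((\<lambda>x. (u0 x, v0 x)) \<longlongrightarrow> (um, vm)) at_bot \<longrightarrow>
        (SUP (x, y)\<in>UNIV. ereal \<bar>riemann_s \<gamma> (u0 x) (v0 x) + riemann_r \<gamma> (u0 y) (v0 y)\<bar>)
          < ereal (1 / (\<gamma> - 1) * um powr (- ((\<gamma> - 1) / 2))) \<longrightarrow>
        maximal_C1_solution \<gamma> \<mu> lam u0 v0 u v \<longrightarrow>
        (\<exists>m1>0. \<exists>\<delta>1>0. \<forall>t\<ge>0. ereal t < lifespan \<gamma> \<mu> lam u0 v0 \<longrightarrow> (u t, v t) \<in> X_set m1 \<delta>1))
     \<and> (\<exists>K>0. \<forall>u0 v0 um vm x0.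
        (u0, v0) \<in> X_set m \<delta> \<longrightarrow> um > 0 \<longrightarrow>
        ((\<lambda>x. (u0 x, v0 x)) \<longlongrightarrow> (um, vm)) at_bot \<longrightarrow>
        (SUP (x, y)\<in>UNIV. ereal \<bar>riemann_s \<gamma> (u0 x) (v0 x) + riemann_r \<gamma> (u0 y) (v0 y)\<bar>)
          < ereal (1 / (\<gamma> - 1) * um powr (- ((\<gamma> - 1) / 2))) \<longrightarrow>
        deriv (\<lambda>x. riemann_r \<gamma> (u0 x) (v0 x)) x0 \<le> - K \<or>
        deriv (\<lambda>x. riemann_s \<gamma> (u0 x) (v0 x)) x0 \<le> - K \<longrightarrow>
        lifespan \<gamma> \<mu> lam u0 v0 < \<infinity>)"
proof -
  have lam: "0 \<le> lam" and \<mu>: "1 \<le> \<mu>" using assms(4) by auto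
  have M: "0 < m + eta \<gamma> \<delta>" using eta_pos[of \<gamma> \<delta>] assms by (simp add: add_pos_pos)
  obtain ul where ul: "0 < ul" "eta \<gamma> ul = m + eta \<gamma> \<delta>" using eta_surj[OF \<open>\<gamma> > 1\<close> M] by blast
  have "0 < eta \<gamma> m / 4" using eta_pos[of \<gamma> m] assms by simp
  then obtain uh where uh: "0 < uh" "eta \<gamma> uh = eta \<gamma> m / 4" using eta_surj[OF \<open>\<gamma> > 1\<close>] by blast
  note bounds = solution_state_bounds[OF \<open>\<gamma> > 1\<close> lam \<open>\<delta> > 0\<close> _ _ _ _ _ _ ul uh]
  show ?thesis
  proof (intro conjI allI impI)
    fix u0 v0 :: "real \<Rightarrow> real" and um vm :: real and u v :: "real \<Rightarrow> real \<Rightarrow> real"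
    assume X: "(u0, v0) \<in> X_set m \<delta>" and um: "um > 0"
      and lim: "((\<lambda>x. (u0 x, v0 x)) \<longlongrightarrow> (um, vm)) at_bot"
      and SUP: "(SUP (x, y)\<in>UNIV. ereal \<bar>riemann_s \<gamma> (u0 x) (v0 x) + riemann_r \<gamma> (u0 y) (v0 y)\<bar>)
          < ereal (1 / (\<gamma> - 1) * um powr (- ((\<gamma> - 1) / 2)))"
      and max: "maximal_C1_solution \<gamma> \<mu> lam u0 v0 u v"
    have "(u t, v t) \<in> X_set (uh + (m + eta \<gamma> \<delta>)) ul"
      if t: "0 \<le> t" "ereal t < lifespan \<gamma> \<mu> lam u0 v0" for t
    proof -
      \<comment> \<open>The strip \<open>{0..<T}\<close> must contain \<open>t\<close>, while the
        solution is only known on strips that end before the lifespan.\<close>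
      obtain T where T: "ereal t < ereal T" "ereal T < lifespan \<gamma> \<mu> lam u0 v0"
        using ereal_dense2[OF t(2)] by blast
      then have "T > 0" "t \<in> {0..<T}" using t(1) by auto
      then have sol: "C1_solution \<gamma> \<mu> lam u0 v0 T u v" "bounded_on_strip \<gamma> T u v"
        using max T(2) by (auto simp: maximal_C1_solution_def)
      note b = bounds[OF um X lim SUP sol \<open>t \<in> {0..<T}\<close>]
      show ?thesis
        by (rule solution_in_X_set[OF \<open>\<gamma> > 1\<close> sol \<open>t \<in> {0..<T}\<close> b ul(1)])
    qed
    then show "\<exists>m1>0. \<exists>\<delta>1>0. \<forall>t\<ge>0. ereal t < lifespan \<gamma> \<mu> lam u0 v0 \<longrightarrow> (u t, v t) \<in> X_set m1 \<delta>1"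
      using ul(1) uh(1) M by (intro exI[of _ "uh + (m + eta \<gamma> \<delta>)"] exI[of _ ul]) auto
  next
    have "0 \<le> lam * \<mu>" using lam \<mu> by simp
    \<comment> \<open>If \<open>m < \<delta>\<close> then \<open>X_set m \<delta>\<close> is empty
      and \<open>ul \<le> uh\<close> can fail; the maximum yields a nonempty interval in every
      case.\<close>
    have "ul \<le> max ul uh" by simp
    from blowup_threshold[OF \<open>\<gamma> > 1\<close> ul(1) this \<open>0 \<le> lam * \<mu>\<close>]
    obtain K T0 where K: "K > 0" and T0:
      "\<And>T l B a a' u v ux vx \<theta> x0.
       \<lbrakk>damped_p_system \<gamma> T l B a u v ux vx; T > 0; \<theta> * \<theta> = 1;
        \<And>t. 0 \<le> t \<Longrightarrow> (a has_real_derivative a' t) (at t);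
        \<And>t. 0 \<le> t \<Longrightarrow> a t \<le> lam * \<mu>; \<And>t. 0 \<le> t \<Longrightarrow> \<bar>a' t\<bar> \<le> lam * \<mu>;
        \<And>t x. t \<in> {0..<T} \<Longrightarrow> u t x \<in> {ul..max ul uh};
        vx 0 x0 + \<theta> * wave_speed \<gamma> (u 0 x0) * ux 0 x0 \<le> - K\<rbrakk> \<Longrightarrow> T \<le> T0"
      by blast
    have le: "lifespan \<gamma> \<mu> lam u0 v0 \<le> ereal T0"
      if X: "(u0, v0) \<in> X_set m \<delta>" and um: "um > 0"
      and lim: "((\<lambda>x. (u0 x, v0 x)) \<longlongrightarrow> (um, vm)) at_bot"
      and SUP: "(SUP (x, y)\<in>UNIV. ereal \<bar>riemann_s \<gamma> (u0 x) (v0 x) + riemann_r \<gamma> (u0 y) (v0 y)\<bar>)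
          < ereal (1 / (\<gamma> - 1) * um powr (- ((\<gamma> - 1) / 2)))"
      and slope: "deriv (\<lambda>x. riemann_r \<gamma> (u0 x) (v0 x)) x0 \<le> - K \<or>
        deriv (\<lambda>x. riemann_s \<gamma> (u0 x) (v0 x)) x0 \<le> - K"
      for u0 v0 um vm x0
      unfolding lifespan_def
    proof (rule Sup_least)
      fix z assume "z \<in> ereal ` {T. T > 0 \<and> (\<exists>u v. C1_solution \<gamma> \<mu> lam u0 v0 T u v \<and> bounded_on_strip \<gamma> T u v)}"
      then obtain T u v where z: "z = ereal T" and T: "T > 0"
        and sol: "C1_solution \<gamma> \<mu> lam u0 v0 T u v" "bounded_on_strip \<gamma> T u v"
        by blast
      obtain l B where sys: "damped_p_system \<gamma> T l B (\<lambda>t. lam / (1 + t) powr \<mu>) u v (pdx u) (pdx v)"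
        by (rule C1_solution_damped_p_system[OF \<open>\<gamma> > 1\<close> lam sol])
      then interpret damped_p_system \<gamma> T l B "\<lambda>t. lam / (1 + t) powr \<mu>" u v "pdx u" "pdx v" .
      have u0: "u0 = u 0" "v0 = v 0" using sol(1) by (auto simp: C1_solution_def fun_eq_iff)
      have "(riemann_inv \<theta> 0 has_real_derivative riemann_inv_x \<theta> 0 x0) (at x0)" if "\<theta> * \<theta> = 1" for \<theta>
        using has_gradient_on_snd[OF riemann_inv_gradient[OF that]] T by auto
      then have "deriv (riemann_inv 1 0) x0 = riemann_inv_x 1 0 x0" "deriv (riemann_inv (- 1) 0) x0 = riemann_inv_x (- 1) 0 x0"
        by (auto intro: DERIV_imp_deriv)
      moreover have "riemann_inv 1 0 = (\<lambda>x. riemann_r \<gamma> (u0 x) (v0 x))" "riemann_inv (- 1) 0 = (\<lambda>x. riemann_s \<gamma> (u0 x) (v0 x))"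
        by (auto simp: riemann_inv_def riemann_r_def riemann_s_def u0 fun_eq_iff)
      ultimately obtain \<theta> where \<theta>: "\<theta> * \<theta> = 1" "riemann_inv_x \<theta> 0 x0 \<le> - K"
        using slope by (metis mult_1 mult_minus1 minus_minus)
      have "T \<le> T0"
      proof (rule T0[OF sys T \<theta>(1) damping_deriv])
        show "u t x \<in> {ul..max ul uh}" if "t \<in> {0..<T}" for t x
          using bounds(1)[OF um X lim SUP sol that, of x] by auto
        show "pdx v 0 x0 + \<theta> * wave_speed \<gamma> (u 0 x0) * pdx u 0 x0 \<le> - K"
          using \<theta>(2) by (simp add: riemann_inv_x_def)
      qed (use damping_bounds[OF lam \<mu>] in auto)
      then show "z \<le> ereal T0" by (simp add: z)
    qed
    have fin: "lifespan \<gamma> \<mu> lam u0 v0 < \<infinity>"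
      if "(u0, v0) \<in> X_set m \<delta>" "um > 0"
        "((\<lambda>x. (u0 x, v0 x)) \<longlongrightarrow> (um, vm)) at_bot"
        "(SUP (x, y)\<in>UNIV. ereal \<bar>riemann_s \<gamma> (u0 x) (v0 x) + riemann_r \<gamma> (u0 y) (v0 y)\<bar>)
          < ereal (1 / (\<gamma> - 1) * um powr (- ((\<gamma> - 1) / 2)))"
        "deriv (\<lambda>x. riemann_r \<gamma> (u0 x) (v0 x)) x0 \<le> - K \<or>
        deriv (\<lambda>x. riemann_s \<gamma> (u0 x) (v0 x)) x0 \<le> - K"
      for u0 v0 um vm x0
      by (rule order_le_less_trans[OF le[OF that]]) simp
    show "\<exists>K>0. \<forall>u0 v0 um vm x0.
        (u0, v0) \<in> X_set m \<delta> \<longrightarrow> um > 0 \<longrightarrow>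
        ((\<lambda>x. (u0 x, v0 x)) \<longlongrightarrow> (um, vm)) at_bot \<longrightarrow>
        (SUP (x, y)\<in>UNIV. ereal \<bar>riemann_s \<gamma> (u0 x) (v0 x) + riemann_r \<gamma> (u0 y) (v0 y)\<bar>)
          < ereal (1 / (\<gamma> - 1) * um powr (- ((\<gamma> - 1) / 2))) \<longrightarrow>
        deriv (\<lambda>x. riemann_r \<gamma> (u0 x) (v0 x)) x0 \<le> - K \<or>
        deriv (\<lambda>x. riemann_s \<gamma> (u0 x) (v0 x)) x0 \<le> - K \<longrightarrow>
        lifespan \<gamma> \<mu> lam u0 v0 < \<infinity>"
      by (intro exI[of _ K] conjI allI impI K) (rule fin)
  qed
qed

end
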